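(* For positive integers $d,n$ let $L_d(n)$ denote the smallest positive integer $N$ such that every $d$-dimensional array of size $N\times\cdots\times N$ contains a lex-monotone subarray of size $n\times\cdots\times n$. Then: (i) $L_2(n)\le 2^{2^{(4+o(1))n^2}}$; (ii) $L_3(n)\le 2^{2^{2^{(2+o(1))n}}}$; (iii) for every $d\ge 4$, $L_d(n)\le \mathrm{towr}_5\left(O_d(n^{d-2})\right)$.
   Context: A $d$-dimensional array is an injective function $f\colon A_1\times\cdots\times A_d\to\mathbb{R}$, where $A_1,\dots,A_d$ are non-empty (finite) subsets of $\mathbb{Z}$; its size is $|A_1|\times\cdots\times|A_d|$. A subarray of $f$ is a restriction of $f$ to $B_1\times\cdots\times B_d$ with non-empty $B_i\subseteq A_i$. For $\mathbf{u},\mathbf{v}\in\mathbb{R}^d$ write $\mathbf{u}<_{\mathrm{lex}}\mathbf{v}$ if $\mathbf{u}\ne\mathbf{v}$ and $u_i<v_i$, where $i$ is the smallest index with $u_i\ne v_i$. A $d$-dimensional array $f$ is lex-monotone if there exist a permutation $\sigma$ of $\{1,\dots,d\}$ and a sign vector $\mathbf{s}\in\{-1,1\}^d$ such that for all $\mathbf{x},\mathbf{y}$ in the domain of $f$, $$f(\mathbf{x})<f(\mathbf{y})\iff (s_{\sigma(1)}x_{\sigma(1)},\dots,s_{\sigma(d)}x_{\sigma(d)})<_{\mathrm{lex}}(s_{\sigma(1)}y_{\sigma(1)},\dots,s_{\sigma(d)}y_{\sigma(d)}).$$ The tower function is defined by $\mathrm{towr}_1(x)=x$ and $\mathrm{towr}_k(x)=2^{\mathrm{towr}_{k-1}(x)}$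 for $k\ge 2$. Asymptotics: $d$ is fixed and $n\to\infty$. The $o(1)$ denotes a quantity depending only on $n$ that tends to $0$ as $n\to\infty$. $O_d(n^{d-2})$ denotes a quantity bounded by $C\,n^{d-2}$ for all positive integers $n$, for some constant $C=C(d)$ depending only on $d$. *)

theory Defs
  imports Complex_Main "HOL-Library.FuncSet" "HOL-Combinatorics.Permutations"
begin

text \<open>Points of \<open>A\<^sub>1 \<times> \<dots> \<times> A\<^sub>d\<close> are functions on the index set \<open>{1..d}\<close>,
  extended by \<open>undefined\<close> outside it, so that the product is in bijection with the set of
  \<open>d\<close>-tuples.\<close>

abbreviation box :: "nat \<Rightarrow> (nat \<Rightarrow> int set) \<Rightarrow> (nat \<Rightarrow> int) set" where
  "box d A \<equiv> Pi\<^sub>E {1..d} A"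

text \<open>Only the values of \<open>f\<close> on \<open>box d A\<close> matter.\<close>

definition is_array :: "nat \<Rightarrow> (nat \<Rightarrow> int set) \<Rightarrow> ((nat \<Rightarrow> int) \<Rightarrow> real) \<Rightarrow> bool" where
  "is_array d A f \<longleftrightarrow>
     (\<forall>i\<in>{1..d}. finite (A i) \<and> A i \<noteq> {}) \<and> inj_on f (box d A)"

definition is_subarray :: "nat \<Rightarrow> (nat \<Rightarrow> int set) \<Rightarrow> ((nat \<Rightarrow> int) \<Rightarrow> real)
    \<Rightarrow> (nat \<Rightarrow> int set) \<Rightarrow> ((nat \<Rightarrow> int) \<Rightarrow> real) \<Rightarrow> bool" where
  "is_subarray d B g A f \<longleftrightarrow>
     (\<forall>i\<in>{1..d}. B i \<noteq> {} \<and> B i \<subseteq> A i) \<and> g = restrict f (box d B)"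

definition cubic_size :: "nat \<Rightarrow> (nat \<Rightarrow> int set) \<Rightarrow> nat \<Rightarrow> bool" where
  "cubic_size d A N \<longleftrightarrow> (\<forall>i\<in>{1..d}. card (A i) = N)"

definition lex_less :: "nat \<Rightarrow> (nat \<Rightarrow> real) \<Rightarrow> (nat \<Rightarrow> real) \<Rightarrow> bool" where
  "lex_less d u v \<longleftrightarrow>
     (\<exists>i\<in>{1..d}. u i \<noteq> v i) \<and>
     (let i = (LEAST i. i \<in> {1..d} \<and> u i \<noteq> v i) in u i < v i)"

definition lex_monotone :: "nat \<Rightarrow> (nat \<Rightarrow> int set) \<Rightarrow> ((nat \<Rightarrow> int) \<Rightarrow> real) \<Rightarrow> bool" where
  "lex_monotone d A f \<longleftrightarrow>
     (\<exists>\<sigma> s. \<sigma> permutes {1..d} \<and> (\<forall>i\<in>{1..d}. s i \<in> {-1, 1 :: int}) \<and>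
       (\<forall>x\<in>box d A. \<forall>y\<in>box d A.
          f x < f y \<longleftrightarrow>
          lex_less d (\<lambda>i. real_of_int (s (\<sigma> i) * x (\<sigma> i)))
                     (\<lambda>i. real_of_int (s (\<sigma> i) * y (\<sigma> i)))))"

definition forces_lex_monotone :: "nat \<Rightarrow> nat \<Rightarrow> nat \<Rightarrow> bool" where
  "forces_lex_monotone d n N \<longleftrightarrow>
     (\<forall>A f. is_array d A f \<and> cubic_size d A N \<longrightarrow>
        (\<exists>B g. is_subarray d B g A f \<and> cubic_size d B n \<and> lex_monotone d B g))"

text \<open>As \<open>LEAST\<close> is unspecified when there is no witness, an upper bound on \<open>L d n\<close> only carries
  its intended meaning together with the existence of a suitable \<open>N\<close>.\<close>

definition L :: "nat \<Rightarrow> nat \<Rightarrow> nat" where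
  "L d n = (LEAST N. N \<ge> 1 \<and> forces_lex_monotone d n N)"

text \<open>The tower function is indexed from 1; the value at index 0 is a dummy.\<close>

fun towr :: "nat \<Rightarrow> real \<Rightarrow> real" where
  "towr 0 x = x"
| "towr (Suc 0) x = x"
| "towr (Suc (Suc k)) x = 2 powr towr (Suc k) x"

end

theory Submission
  imports Defs "HOL-Real_Asymp.Real_Asymp"
begin

text \<open>First pass to a subarray that is monotone along every coordinate, then to a lex-monotone one.

Both passes to monotone subarrays rest on one remark: if all pairs of a linear order are covered by
\<open>C\<close> transitive relations, then more than \<open>(n - 1) ^ C\<close> elements contain an
\<open>n\<close>-chain for one of them. Given many \<open>(d - 1)\<close>-dimensional slices which are
monotone on a common box \<open>P\<close>, colour a pair of slices by a subbox of \<open>P\<close> on which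
the sign of their difference is constant; this keeps the bounds doubly exponential for
\<open>d \<le> 3\<close>. For larger \<open>d\<close> colour the pair by the whole sign pattern on
\<open>P\<close> instead, and make the directions of the resulting monotone lines agree at the end by a
\<open>d\<close>-partite Ramsey argument, at the cost of one more exponential.

In an increasing array, an elimination argument on a bounded grid of windows yields a coordinate
\<open>i\<close> that beats all others jointly on a subarray whose sides shrink only by a factor linear
in the number \<open>u\<close> of values kept for \<open>i\<close>. The slices at these \<open>u\<close> values are
made lexicographic by induction, and \<open>u\<close> is chosen so large that \<open>n\<close> of them
share the same box and the same order of coordinates. In two dimensions polynomial size suffices;
in three, a greedy choice of common windows reduces \<open>u\<close> to \<open>2 ^ n\<close> times a
polynomial, which the constant 2 in the bound for \<open>L 3 n\<close> requires.\<close>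

section \<open>Transitive colourings\<close>

text \<open>The side \<open>K\<close> of the increasing array fixes the leading constants. In the
  plane \<open>K = 2 * n ^ 2\<close>, and two slices are compared on one of
  \<open>(2 * K) choose K \<le> 4 ^ K\<close> subsets of a line; this is
  \<open>2 ^ (4 * n ^ 2)\<close>, everything else in that exponent being polynomial. In dimension
  three \<open>K\<close> is \<open>2 ^ n\<close> times a polynomial. Ramsey for the base plane needs
  a side exponential in \<open>K\<close>, and choosing \<open>K\<close> of its values gives at most
  \<open>2 ^ (7 * K ^ 2)\<close> colours; the square of \<open>2 ^ n\<close> is the 2 in the bound
  for \<open>L 3 n\<close>.

  From dimension four on, subboxes are too expensive as colours. The three-dimensional slices would
  have to be monotone on a box with a side already exponential in \<open>K\<close>, so the colours
  inside them, which are subsets of that size, would be doubly exponential in number, and each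
  further dimension nests deeper. Sign patterns do not nest: every dimension works with the same
  side \<open>m\<close>, and only the final agreement of directions makes \<open>m\<close>
  exponential in \<open>K\<close>.\<close>

lemma pigeonhole_relation:
  assumes "finite K" and "finite Z" and "Z \<noteq> {}"
    and choice: "\<And>z. z \<in> Z \<Longrightarrow> \<exists>\<kappa>\<in>K. P z \<kappa>"
    and card: "card K * v \<le> card Z"
  shows "\<exists>\<kappa>\<in>K. \<exists>Z'\<subseteq>Z. card Z' = v \<and> (\<forall>z\<in>Z'. P z \<kappa>)"
proof -
  obtain k where k: "\<And>z. z \<in> Z \<Longrightarrow> k z \<in> K \<and> P z (k z)"
    using choice by metis
  have "\<exists>\<kappa>\<in>K. v \<le> card {z\<in>Z. k z = \<kappa>}"
  proof (rule ccontr)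
    assume "\<not> ?thesis"
    then have less: "\<And>\<kappa>. \<kappa> \<in> K \<Longrightarrow> card {z\<in>Z. k z = \<kappa>} < v" by force
    \<comment> \<open>This is where \<open>Z \<noteq> {}\<close> enters: the count
      \<open>card K * v\<close> alone would allow an empty \<open>K\<close>.\<close>
    have "K \<noteq> {}" using \<open>Z \<noteq> {}\<close> k by blast
    have "card Z = (\<Sum>\<kappa>\<in>K. card {z\<in>Z. k z = \<kappa>})"
      using sum.group[of Z K k "\<lambda>_. 1::nat"] assms(1,2) k by (simp add: image_subset_iff)
    also have "\<dots> < (\<Sum>\<kappa>\<in>K. v)"
      using less \<open>K \<noteq> {}\<close> \<open>finite K\<close> by (intro sum_strict_mono) auto
    finally show False using card by simp
  qed
  then obtain \<kappa> where \<kappa>: "\<kappa> \<in> K" "v \<le> card {z\<in>Z. k z = \<kappa>}" by blast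
  then obtain Z' where "Z' \<subseteq> {z\<in>Z. k z = \<kappa>}" "card Z' = v"
    by (meson obtain_subset_with_card_n)
  then show ?thesis using \<kappa>(1) k by (intro bexI[of _ \<kappa>] exI[of _ Z']) auto
qed

text \<open>Erdos-Szekeres labelling, one colour at a time. Label \<open>z\<close> by the length of
  the longest \<open>c\<close>-chain ending in it. Without an \<open>n\<close>-chain there are at
  most \<open>n - 1\<close> labels, and a pair with equal labels cannot have colour
  \<open>c\<close>, since transitivity would extend the chain. So some label class is large and is
  covered by the remaining colours.\<close>

lemma transitive_colours_chain:
  fixes Z :: "'a::linorder set"
  assumes "finite C" and "finite Z" and "(n - 1) ^ card C < card Z" and "1 \<le> n"
    and trans: "\<And>c x y z. c \<in> C \<Longrightarrow> R c x y \<Longrightarrow> R c y z \<Longrightarrow> R c x z"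
    and cover: "\<And>x y. x \<in> Z \<Longrightarrow> y \<in> Z \<Longrightarrow> x < y \<Longrightarrow> \<exists>c\<in>C. R c x y"
  shows "\<exists>c\<in>C. \<exists>Z'\<subseteq>Z. card Z' = n \<and> (\<forall>x\<in>Z'. \<forall>y\<in>Z'. x < y \<longrightarrow> R c x y)"
  using assms(1,2,3,5,6)
proof (induction C arbitrary: Z rule: finite_induct)
  case empty
  \<comment> \<open>\<open>(n - 1) ^ 0 = 1\<close>, so there are two elements, and their pair has no
    colour.\<close>
  then have "\<not> card Z \<le> 1" by simp
  then obtain x y where "x \<in> Z" "y \<in> Z" "x \<noteq> y"
    by (metis One_nat_def card_le_Suc0_iff_eq empty.prems(1))
  then show ?case using empty.prems(4) by (meson empty_iff linorder_neqE)
next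
  case (insert c C)
  define chain where "chain T \<longleftrightarrow> T \<subseteq> Z \<and> (\<forall>x\<in>T. \<forall>y\<in>T. x < y \<longrightarrow> R c x y)" for T
  show ?case
  proof (cases "\<exists>T. chain T \<and> n \<le> card T")
    case True
    then obtain T Z' where "chain T" "Z' \<subseteq> T" "card Z' = n"
      by (meson obtain_subset_with_card_n)
    then show ?thesis by (intro bexI[of _ c] exI[of _ Z']) (auto simp: chain_def)
  next
    case False
    define S where "S z = {T. chain T \<and> z \<in> T \<and> (\<forall>t\<in>T. t \<le> z)}" for z
    define h where "h z = Max (card ` S z)" for z
    have finS: "finite (card ` S z)" for z
      by (rule finite_imageI, rule finite_subset[of _ "Pow Z"]) (auto simp: S_def chain_def insert.prems(1))
    have sing: "{z} \<in> S z" if "z \<in> Z" for z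
      using that by (auto simp: S_def chain_def)
    have h_in: "h z \<in> card ` S z" if "z \<in> Z" for z
      unfolding h_def using finS sing[OF that] by (intro Max_in) auto
    have h_range: "h z \<in> {1..<n}" if "z \<in> Z" for z
    proof -
      have "card {z} \<le> h z" unfolding h_def using finS sing[OF that] by (intro Max_ge imageI)
      moreover have "h z < n" using h_in[OF that] False by (auto simp: S_def not_le)
      ultimately show ?thesis by simp
    qed
    have "\<exists>\<kappa>\<in>{1..<n}. (n - 1) ^ card C < card {z\<in>Z. h z = \<kappa>}"
    proof (rule ccontr)
      assume neg: "\<not> ?thesis"
      have "card Z = (\<Sum>\<kappa>\<in>{1..<n}. card {z\<in>Z. h z = \<kappa>})"
        using sum.group[of Z "{1..<n}" h "\<lambda>_. 1::nat"] insert.prems(1) h_range by (simp add: image_subset_iff)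
      also have "\<dots> \<le> (\<Sum>\<kappa>\<in>{1..<n}. (n - 1) ^ card C)"
        using neg by (intro sum_mono) force
      finally show False using insert.prems(2) insert.hyps by simp
    qed
    then obtain \<kappa> where \<kappa>: "(n - 1) ^ card C < card {z\<in>Z. h z = \<kappa>}" by blast
    have noR: "\<not> R c x y" if xZ: "x \<in> Z" and "y \<in> Z" "h x = h y" "x < y" for x y
    proof
      assume R: "R c x y"
      obtain T where T: "T \<in> S x" "h x = card T" using h_in[OF xZ] by auto
      have "finite T" using T(1) insert.prems(1) finite_subset by (auto simp: S_def chain_def)
      have "R c t y" if "t \<in> T" for t
        using that T(1) R insert.prems(3)[of c t x y] unfolding S_def chain_def
        by (metis (mono_tags, lifting) insertI1 le_neq_trans mem_Collect_eq)
      moreover have "t < y" if "t \<in> T" for t using that T(1) \<open>x < y\<close> by (auto simp: S_def)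
      ultimately have "insert y T \<in> S y"
        using T(1) \<open>y \<in> Z\<close> unfolding S_def chain_def by (auto dest: less_asym less_imp_le)
      then have "card (insert y T) \<le> h y" unfolding h_def using finS by (intro Max_ge) auto
      moreover have "y \<notin> T" using T(1) \<open>x < y\<close> by (auto simp: S_def)
      ultimately show False using T(2) \<open>finite T\<close> \<open>h x = h y\<close> by simp
    qed
    have "\<exists>d\<in>C. \<exists>Z'\<subseteq>{z\<in>Z. h z = \<kappa>}. card Z' = n \<and> (\<forall>x\<in>Z'. \<forall>y\<in>Z'. x < y \<longrightarrow> R d x y)"
    proof (rule insert.IH)
      show "finite {z\<in>Z. h z = \<kappa>}" using insert.prems(1) by simp
      show "\<exists>d\<in>C. R d x y" if "x \<in> {z\<in>Z. h z = \<kappa>}" "y \<in> {z\<in>Z. h z = \<kappa>}" "x < y" for x y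
        using insert.prems(4)[of x y] noR[of x y] that by auto
    qed (use \<kappa> insert.prems(3) in blast)+
    then show ?thesis by blast
  qed
qed

section \<open>Uniformly monotone subarrays by recursion on the dimension\<close>

text \<open>Extensional in the index, so that there are only finitely many: subboxes serve as keys
  and colours and have to be counted.\<close>

definition sub_boxes :: "nat set \<Rightarrow> (nat \<Rightarrow> int set) \<Rightarrow> (nat \<Rightarrow> nat) \<Rightarrow> (nat \<Rightarrow> int set) set" where
  "sub_boxes D A q = Pi\<^sub>E D (\<lambda>i. {T. T \<subseteq> A i \<and> card T = q i})"

lemma sub_boxesD:
  "B \<in> sub_boxes D A q \<Longrightarrow> i \<in> D \<Longrightarrow> B i \<subseteq> A i \<and> card (B i) = q i"
  by (auto simp: sub_boxes_def dest: PiE_mem)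

lemma finite_sub_boxes:
  "finite D \<Longrightarrow> (\<And>i. i \<in> D \<Longrightarrow> finite (A i)) \<Longrightarrow> finite (sub_boxes D A q)"
  unfolding sub_boxes_def by (intro finite_PiE) auto

lemma card_sub_boxes:
  assumes "finite D" and "\<And>i. i \<in> D \<Longrightarrow> finite (A i)"
  shows "card (sub_boxes D A q) = (\<Prod>i\<in>D. card (A i) choose q i)"
  using assms by (simp add: sub_boxes_def card_PiE n_subsets)

lemma sub_boxes_trans:
  assumes "B \<in> sub_boxes D A q" and "C \<in> sub_boxes D B p"
  shows "C \<in> sub_boxes D A p"
  unfolding sub_boxes_def
proof (rule PiE_I)
  show "C i \<in> {T. T \<subseteq> A i \<and> card T = p i}" if "i \<in> D" for i
    using sub_boxesD[OF assms(1) that] sub_boxesD[OF assms(2) that] by auto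
  show "C i = undefined" if "i \<notin> D" for i
    using assms(2) that by (auto simp: sub_boxes_def)
qed

lemma sub_boxes_insert:
  assumes "B \<in> sub_boxes D A q" and "T \<subseteq> A j" and "card T = q j"
  shows "B(j := T) \<in> sub_boxes (insert j D) A q"
  using assms unfolding sub_boxes_def by (intro PiE_fun_upd) auto

lemma exists_sub_box:
  assumes "\<And>i. i \<in> D \<Longrightarrow> q i \<le> card (A i)"
  shows "\<exists>B. B \<in> sub_boxes D A q"
proof -
  have "\<forall>i\<in>D. \<exists>T. T \<subseteq> A i \<and> card T = q i"
    using assms by (meson obtain_subset_with_card_n)
  then show ?thesis
    using PiE_eq_empty_iff[of D "\<lambda>i. {T. T \<subseteq> A i \<and> card T = q i}"] unfolding sub_boxes_def by blast
qed

lemma box_sub_box: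
  "B \<in> sub_boxes D A q \<Longrightarrow> x \<in> Pi\<^sub>E D B \<Longrightarrow> x \<in> Pi\<^sub>E D A"
  using sub_boxesD by (meson PiE_mono subsetD)

lemma box_insertE:
  assumes "x \<in> Pi\<^sub>E (insert j D) A"
  obtains y a where "y \<in> Pi\<^sub>E D A" "a \<in> A j" "x = y(j := a)"
  using assms by (auto simp: PiE_insert_eq)

lemma box_updI: "x \<in> Pi\<^sub>E D A \<Longrightarrow> z \<in> A j \<Longrightarrow> x(j := z) \<in> Pi\<^sub>E (insert j D) A"
  by (rule PiE_fun_upd)

lemma box_upd_notin: "j \<notin> D \<Longrightarrow> Pi\<^sub>E D (B(j := T)) = Pi\<^sub>E D B"
  by (intro PiE_cong) auto

section \<open>Partite Ramsey theorem for boxes\<close>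

text \<open>Ramsey property of complete \<open>D\<close>-partite hypergraphs: the sides are the
  vertex classes and the points of the box are the edges.\<close>

definition box_ramsey :: "nat set \<Rightarrow> (nat \<Rightarrow> nat) \<Rightarrow> (nat \<Rightarrow> nat) \<Rightarrow> nat \<Rightarrow> bool" where
  "box_ramsey D q p r \<longleftrightarrow>
     (\<forall>A c. (\<forall>i\<in>D. finite (A i) \<and> q i \<le> card (A i)) \<and> (\<forall>x\<in>Pi\<^sub>E D A. c x < r) \<longrightarrow>
        (\<exists>B\<in>sub_boxes D A p. \<exists>\<kappa><r. \<forall>x\<in>Pi\<^sub>E D B. c x = (\<kappa>::nat)))"

lemma box_ramsey_empty: "box_ramsey {} q p r"
  unfolding box_ramsey_def sub_boxes_def by auto

text \<open>Every value of coordinate \<open>j\<close> has as key a monochromatic subbox of its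
  slice together with the colour; \<open>p j\<close> values with a common key span the new
  box.\<close>

lemma box_ramsey_insert:
  assumes "box_ramsey D q p r" and "finite D" and "j \<notin> D"
    and card: "(\<Prod>i\<in>D. q i choose p i) * r * p j \<le> q j" and "0 < q j"
  shows "box_ramsey (insert j D) q p r"
  unfolding box_ramsey_def
proof (intro allI impI, elim conjE)
  fix A and c :: "(nat \<Rightarrow> int) \<Rightarrow> nat"
  assume A: "\<forall>i\<in>insert j D. finite (A i) \<and> q i \<le> card (A i)"
    and c: "\<forall>x\<in>Pi\<^sub>E (insert j D) A. c x < r"
  \<comment> \<open>The sides are cut to exactly \<open>q i\<close>, because the number of keys
    grows with them.\<close>
  obtain A' where A': "A' \<in> sub_boxes D A q" using A exists_sub_box[of D q A] by blast
  have finA': "finite (A' i)" "card (A' i) = q i" if "i \<in> D" for i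
    using sub_boxesD[OF A' that] A that finite_subset by auto
  define K where "K = sub_boxes D A' p \<times> {..<r}"
  have "finite K" unfolding K_def using finite_sub_boxes[of D A' p] finA' \<open>finite D\<close> by auto
  have "card K = (\<Prod>i\<in>D. q i choose p i) * r"
    unfolding K_def using finA' \<open>finite D\<close> by (simp add: card_cartesian_product card_sub_boxes)
  have "\<exists>\<kappa>\<in>K. \<exists>Z\<subseteq>A j. card Z = p j \<and> (\<forall>z\<in>Z. \<forall>x\<in>Pi\<^sub>E D (fst \<kappa>). c (x(j := z)) = snd \<kappa>)"
  proof (rule pigeonhole_relation)
    show "finite K" by fact
    show "finite (A j)" using A by simp
    show "A j \<noteq> {}" using A \<open>0 < q j\<close> by auto
    have "card K * p j \<le> q j" using card \<open>card K = _\<close> by simp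
    then show "card K * p j \<le> card (A j)" using A by (meson insertI1 le_trans)
    show "\<exists>\<kappa>\<in>K. \<forall>x\<in>Pi\<^sub>E D (fst \<kappa>). c (x(j := z)) = snd \<kappa>" if "z \<in> A j" for z
    proof -
      have "\<forall>x\<in>Pi\<^sub>E D A'. c (x(j := z)) < r"
        using c box_updI[OF box_sub_box[OF A'] that] by blast
      then have "\<exists>B\<in>sub_boxes D A' p. \<exists>\<kappa><r. \<forall>x\<in>Pi\<^sub>E D B. c (x(j := z)) = \<kappa>"
        using assms(1)[unfolded box_ramsey_def, rule_format, of A' "\<lambda>x. c (x(j := z))"] finA' by auto
      then show ?thesis unfolding K_def by force
    qed
  qed
  then obtain B \<kappa> Z where B: "B \<in> sub_boxes D A' p" "\<kappa> < r" "Z \<subseteq> A j" "card Z = p j"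
    "\<forall>z\<in>Z. \<forall>x\<in>Pi\<^sub>E D B. c (x(j := z)) = \<kappa>"
    unfolding K_def by fastforce
  have "B(j := Z) \<in> sub_boxes (insert j D) A p"
    using sub_boxes_insert[OF sub_boxes_trans[OF A' B(1)], of Z j] B(3,4) by auto
  moreover have "c x = \<kappa>" if "x \<in> Pi\<^sub>E (insert j D) (B(j := Z))" for x
    using that B(5) by (elim box_insertE) (auto simp: box_upd_notin[OF \<open>j \<notin> D\<close>])
  ultimately show "\<exists>B\<in>sub_boxes (insert j D) A p. \<exists>\<kappa><r. \<forall>x\<in>Pi\<^sub>E (insert j D) B. c x = \<kappa>"
    using B(2) by blast
qed

section \<open>Monotonicity with one direction per coordinate\<close>

definition monotone_pattern :: "nat set \<Rightarrow> nat set \<Rightarrow> (nat \<Rightarrow> int set) \<Rightarrow> ((nat \<Rightarrow> int) \<Rightarrow> real) \<Rightarrow> bool" where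
  "monotone_pattern S D B f \<longleftrightarrow>
     (\<forall>i\<in>D. \<forall>x\<in>Pi\<^sub>E D B. \<forall>b\<in>B i. x i < b \<longrightarrow>
        (if i \<in> S then f x < f (x(i := b)) else f (x(i := b)) < f x))"

definition forces_monotone :: "nat set \<Rightarrow> (nat \<Rightarrow> nat) \<Rightarrow> (nat \<Rightarrow> nat) \<Rightarrow> bool" where
  "forces_monotone D Q q \<longleftrightarrow>
     (\<forall>A f. (\<forall>i\<in>D. finite (A i) \<and> Q i \<le> card (A i)) \<and> inj_on f (Pi\<^sub>E D A) \<longrightarrow>
        (\<exists>B\<in>sub_boxes D A q. \<exists>S\<subseteq>D. monotone_pattern S D B f))"

lemma forces_monotone_empty: "forces_monotone {} Q q"
  unfolding forces_monotone_def monotone_pattern_def sub_boxes_def by auto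

lemma inj_on_slice:
  assumes "inj_on f (Pi\<^sub>E (insert j D) A)" and "z \<in> A j" and "j \<notin> D"
  shows "inj_on (\<lambda>x. f (x(j := z))) (Pi\<^sub>E D A)"
proof (rule inj_onI)
  fix x y assume xy: "x \<in> Pi\<^sub>E D A" "y \<in> Pi\<^sub>E D A" "f (x(j := z)) = f (y(j := z))"
  have "x(j := z) \<in> Pi\<^sub>E (insert j D) A" "y(j := z) \<in> Pi\<^sub>E (insert j D) A"
    using box_updI[OF xy(1) assms(2)] box_updI[OF xy(2) assms(2)] by auto
  then have "x(j := z) = y(j := z)" using assms(1) xy(3) by (meson inj_onD)
  moreover have "x j = y j" using xy(1,2) assms(3) by (metis PiE_arb)
  ultimately show "x = y" by (metis fun_upd_triv fun_upd_upd)
qed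

text \<open>The intermediate sides \<open>q\<close> leave room for Ramsey. Slices monotone on a
  common \<open>q\<close>-box are compared in pairs, and each pair has a constant sign on some
  \<open>p\<close>-subbox. Subbox and sign form a transitive colour, because the comparison holds at
  every point of the subbox.\<close>

lemma forces_monotone_insert:
  assumes "forces_monotone D Q q" and "box_ramsey D q p 2" and "finite D" and "j \<notin> D"
    and "1 \<le> p j"
    and Qj: "(\<Prod>i\<in>D. Q i choose q i) * 2 ^ card D * ((p j - 1) ^ (2 * (\<Prod>i\<in>D. q i choose p i)) + 1) \<le> Q j"
    and "0 < Q j"
  shows "forces_monotone (insert j D) Q p"
  unfolding forces_monotone_def
proof (intro allI impI, elim conjE)
  fix A and f :: "(nat \<Rightarrow> int) \<Rightarrow> real"
  assume A: "\<forall>i\<in>insert j D. finite (A i) \<and> Q i \<le> card (A i)"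
    and inj: "inj_on f (Pi\<^sub>E (insert j D) A)"
  define N where "N = (p j - 1) ^ (2 * (\<Prod>i\<in>D. q i choose p i)) + 1"
  obtain A' where A': "A' \<in> sub_boxes D A Q" using A exists_sub_box[of D Q A] by blast
  have finA': "finite (A' i)" "card (A' i) = Q i" if "i \<in> D" for i
    using sub_boxesD[OF A' that] A that finite_subset by auto
  define K where "K = sub_boxes D A' q \<times> Pow D"
  have "finite K" unfolding K_def using finite_sub_boxes[of D A' q] finA' \<open>finite D\<close> by auto
  have "card K = (\<Prod>i\<in>D. Q i choose q i) * 2 ^ card D"
    unfolding K_def using finA' \<open>finite D\<close>
    by (simp add: card_cartesian_product card_sub_boxes card_Pow)
  have "\<exists>\<kappa>\<in>K. \<exists>Z\<subseteq>A j. card Z = N \<and>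
      (\<forall>z\<in>Z. monotone_pattern (snd \<kappa>) D (fst \<kappa>) (\<lambda>x. f (x(j := z))))"
  proof (rule pigeonhole_relation)
    show "finite K" by fact
    show "finite (A j)" using A by simp
    show "A j \<noteq> {}" using A \<open>0 < Q j\<close> by auto
    have "card K * N \<le> Q j" using Qj \<open>card K = _\<close> N_def by simp
    then show "card K * N \<le> card (A j)" using A by (meson insertI1 le_trans)
    show "\<exists>\<kappa>\<in>K. monotone_pattern (snd \<kappa>) D (fst \<kappa>) (\<lambda>x. f (x(j := z)))" if "z \<in> A j" for z
    proof -
      have "inj_on (\<lambda>x. f (x(j := z))) (Pi\<^sub>E D A')"
        using inj_on_slice[OF inj that \<open>j \<notin> D\<close>] box_sub_box[OF A'] by (meson inj_on_subset subsetI)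
      then have "\<exists>B\<in>sub_boxes D A' q. \<exists>S\<subseteq>D. monotone_pattern S D B (\<lambda>x. f (x(j := z)))"
        using assms(1)[unfolded forces_monotone_def, rule_format, of A' "\<lambda>x. f (x(j := z))"] finA' by auto
      then show ?thesis unfolding K_def by force
    qed
  qed
  then obtain B S Z where B: "B \<in> sub_boxes D A' q" "S \<subseteq> D" "Z \<subseteq> A j" "card Z = N"
    "\<forall>z\<in>Z. monotone_pattern S D B (\<lambda>x. f (x(j := z)))"
    unfolding K_def by fastforce
  have BA: "B \<in> sub_boxes D A q" using sub_boxes_trans[OF A' B(1)] .
  have finB: "finite (B i)" "card (B i) = q i" if "i \<in> D" for i
    using sub_boxesD[OF BA that] A that finite_subset by auto
  define C where "C = sub_boxes D B p \<times> (UNIV :: bool set)"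
  define R where "R = (\<lambda>(P, up) y z. \<forall>x\<in>Pi\<^sub>E D P.
      if up then f (x(j := y)) < f (x(j := z)) else f (x(j := z)) < f (x(j := y)))"
  have cardC: "card C = 2 * (\<Prod>i\<in>D. q i choose p i)"
    unfolding C_def using finB \<open>finite D\<close> by (simp add: card_cartesian_product card_sub_boxes)
  have "\<exists>c\<in>C. \<exists>Z'\<subseteq>Z. card Z' = p j \<and> (\<forall>x\<in>Z'. \<forall>y\<in>Z'. x < y \<longrightarrow> R c x y)"
  proof (rule transitive_colours_chain)
    show "finite C" unfolding C_def using finite_sub_boxes[of D B p] finB \<open>finite D\<close> by auto
    show "finite Z" using B(4) N_def by (metis add_is_0 card.infinite one_neq_zero)
    show "(p j - 1) ^ card C < card Z" using B(4) N_def cardC by simp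
    show "R c x z" if "R c x y" "R c y z" for c x y z
      using that unfolding R_def by (cases c) (fastforce split: if_splits)
    show "\<exists>c\<in>C. R c y z" if yz: "y \<in> Z" "z \<in> Z" "y < z" for y z
    proof -
      \<comment> \<open>Two colours suffice, as injectivity of \<open>f\<close> excludes
        equality.\<close>
      define c :: "(nat \<Rightarrow> int) \<Rightarrow> nat" where "c x = of_bool (f (x(j := y)) < f (x(j := z)))" for x
      have "\<exists>P\<in>sub_boxes D B p. \<exists>\<kappa><2. \<forall>x\<in>Pi\<^sub>E D P. c x = \<kappa>"
        using assms(2)[unfolded box_ramsey_def, rule_format, of B c] finB by (auto simp: c_def)
      then obtain P \<kappa> where P: "P \<in> sub_boxes D B p" "\<forall>x\<in>Pi\<^sub>E D P. c x = \<kappa>" by blast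
      have "R (P, \<kappa> = 1) y z"
        unfolding R_def split
      proof (intro ballI)
        fix x assume x: "x \<in> Pi\<^sub>E D P"
        have xA: "x \<in> Pi\<^sub>E D A" using box_sub_box[OF BA box_sub_box[OF P(1) x]] .
        have "x(j := y) \<in> Pi\<^sub>E (insert j D) A" "x(j := z) \<in> Pi\<^sub>E (insert j D) A"
          using box_updI[OF xA] yz(1,2) B(3) by blast+
        moreover have "x(j := y) \<noteq> x(j := z)" using yz(3) by (metis fun_upd_same less_irrefl)
        ultimately have "f (x(j := y)) \<noteq> f (x(j := z))" using inj by (meson inj_onD)
        then show "if \<kappa> = 1 then f (x(j := y)) < f (x(j := z)) else f (x(j := z)) < f (x(j := y))"
          using P(2) x by (fastforce simp: c_def)
      qed
      then show ?thesis using P(1) unfolding C_def by blast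
    qed
  qed (use \<open>1 \<le> p j\<close> in auto)
  then obtain P up Z' where P: "P \<in> sub_boxes D B p" "Z' \<subseteq> Z" "card Z' = p j"
    "\<forall>x\<in>Z'. \<forall>y\<in>Z'. x < y \<longrightarrow> R (P, up) x y"
    unfolding C_def by blast
  have sub: "P(j := Z') \<in> sub_boxes (insert j D) A p"
    using sub_boxes_insert[OF sub_boxes_trans[OF BA P(1)], of Z' j] P(2,3) B(3) by auto
  define S' where "S' = (if up then insert j S else S)"
  have "monotone_pattern S' (insert j D) (P(j := Z')) f"
    unfolding monotone_pattern_def
  proof (intro ballI impI)
    fix i x b
    assume i: "i \<in> insert j D" and x: "x \<in> Pi\<^sub>E (insert j D) (P(j := Z'))"
      and b: "b \<in> (P(j := Z')) i" "x i < b"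
    obtain y a where y: "y \<in> Pi\<^sub>E D P" "a \<in> Z'" "x = y(j := a)"
      using x by (elim box_insertE) (auto simp: box_upd_notin[OF \<open>j \<notin> D\<close>])
    show "if i \<in> S' then f x < f (x(i := b)) else f (x(i := b)) < f x"
    proof (cases "i = j")
      case True
      then have "R (P, up) a b" using P(4) b y by auto
      moreover have "j \<notin> S" using B(2) \<open>j \<notin> D\<close> by auto
      ultimately show ?thesis using y True by (auto simp: R_def S'_def)
    next
      case False
      then have "i \<in> D" using i by simp
      have "b \<in> B i" using b False sub_boxesD[OF P(1) \<open>i \<in> D\<close>] by auto
      moreover have "y \<in> Pi\<^sub>E D B" using box_sub_box[OF P(1) y(1)] .
      moreover have "a \<in> Z" using y(2) P(2) by auto
      ultimately have "if i \<in> S then f (y(j := a)) < f (y(i := b, j := a))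
          else f (y(i := b, j := a)) < f (y(j := a))"
        using B(5) \<open>i \<in> D\<close> b(2) y(3) False unfolding monotone_pattern_def by auto
      then show ?thesis using y(3) False by (auto simp: S'_def fun_upd_twist)
    qed
  qed
  moreover have "S' \<subseteq> insert j D" using B(2) by (auto simp: S'_def)
  ultimately show "\<exists>B\<in>sub_boxes (insert j D) A p. \<exists>S\<subseteq>insert j D. monotone_pattern S (insert j D) B f"
    using sub by blast
qed

section \<open>A leading coordinate in an increasing array\<close>

lemma monotone_pattern_slice:
  assumes "monotone_pattern S D A f" and "j \<in> D" and "z \<in> A j"
  shows "monotone_pattern S (D - {j}) A (\<lambda>x. f (x(j := z)))"
  unfolding monotone_pattern_def
proof (intro ballI impI)
  fix i x b
  assume i: "i \<in> D - {j}" and x: "x \<in> Pi\<^sub>E (D - {j}) A" and b: "b \<in> A i" "x i < b"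
  have "x(j := z) \<in> Pi\<^sub>E D A" using box_updI[of x "D - {j}" A z j] x assms(2,3) by (simp add: insert_absorb)
  then have "if i \<in> S then f (x(j := z)) < f (x(j := z, i := b)) else f (x(j := z, i := b)) < f (x(j := z))"
    using assms(1) i b unfolding monotone_pattern_def by auto
  then show "if i \<in> S then f (x(j := z)) < f (x(i := b, j := z)) else f (x(i := b, j := z)) < f (x(j := z))"
    using i fun_upd_twist[of i j x b z] by auto
qed

lemma monotone_pattern_subset:
  assumes "monotone_pattern S D A f" and sub: "\<And>i. i \<in> D \<Longrightarrow> B i \<subseteq> A i"
  shows "monotone_pattern S D B f"
proof -
  have "Pi\<^sub>E D B \<subseteq> Pi\<^sub>E D A" using sub by (rule PiE_mono)
  then show ?thesis using assms unfolding monotone_pattern_def by blast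
qed

text \<open>A pattern compares only points that differ in one coordinate, so the coordinates are
  raised from \<open>x\<close> to \<open>y\<close> one by one inside the box.\<close>

lemma increasing_le:
  assumes f: "monotone_pattern D D A f" and "finite D"
    and x: "x \<in> Pi\<^sub>E D A" and y: "y \<in> Pi\<^sub>E D A" and le: "\<And>i. i \<in> D \<Longrightarrow> x i \<le> y i"
  shows "f x \<le> f y"
proof -
  define m where "m E = (\<lambda>i. if i \<in> E then y i else x i)" for E
  have "f x \<le> f (m E)" if "E \<subseteq> D" for E
    using finite_subset[OF that \<open>finite D\<close>] that
  proof (induction E rule: finite_induct)
    case empty
    then show ?case by (simp add: m_def)
  next
    case (insert i E)
    have mE: "m E \<in> Pi\<^sub>E D A" using x y insert.prems by (auto simp: m_def PiE_iff extensional_def)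
    have eq: "m (insert i E) = (m E)(i := y i)" by (auto simp: m_def fun_eq_iff)
    have "m E i = x i" using insert.hyps by (simp add: m_def)
    have "i \<in> D" using insert.prems by simp
    have "f (m E) \<le> f (m (insert i E))"
    proof (cases "x i = y i")
      case True
      then show ?thesis using eq \<open>m E i = x i\<close> by (metis fun_upd_triv order_refl)
    next
      case False
      then have "m E i < y i" using le[OF \<open>i \<in> D\<close>] \<open>m E i = x i\<close> by simp
      moreover have "y i \<in> A i" using y \<open>i \<in> D\<close> by (auto dest: PiE_mem)
      ultimately show ?thesis
        using f mE \<open>i \<in> D\<close> eq unfolding monotone_pattern_def by (metis less_imp_le)
    qed
    then show ?case using insert by auto
  qed
  moreover have "m D = y"
  proof
    show "m D i = y i" for i using PiE_arb[OF x, of i] PiE_arb[OF y, of i] by (auto simp: m_def)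
  qed
  ultimately show ?thesis by (metis order_refl)
qed

lemma increasing_less:
  assumes f: "monotone_pattern D D A f" and "finite D"
    and x: "x \<in> Pi\<^sub>E D A" and y: "y \<in> Pi\<^sub>E D A" and le: "\<And>i. i \<in> D \<Longrightarrow> x i \<le> y i"
    and i: "i \<in> D" "x i < y i"
  shows "f x < f y"
proof -
  have yi: "y i \<in> A i" using y i(1) by (auto dest: PiE_mem)
  have "f x < f (x(i := y i))" using f x i yi unfolding monotone_pattern_def by auto
  also have "\<dots> \<le> f y"
  proof (rule increasing_le[OF f \<open>finite D\<close> _ y])
    show "x(i := y i) \<in> Pi\<^sub>E D A" using box_updI[of x D A "y i" i] x yi i(1) by (simp add: insert_absorb)
    show "(x(i := y i)) j \<le> y j" if "j \<in> D" for j using le[OF that] by simp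
  qed
  finally show ?thesis .
qed

lemma finite_set_enumeration:
  fixes A :: "int set"
  assumes "finite A" and "N \<le> card A"
  obtains e :: "nat \<Rightarrow> int" where "\<And>k. k < N \<Longrightarrow> e k \<in> A" "strict_mono_on {..<N} e"
proof
  let ?e = "(!) (sorted_list_of_set A)"
  show "?e k \<in> A" if "k < N" for k
    using assms that by (metis length_sorted_list_of_set nth_mem order_less_le_trans set_sorted_list_of_set)
  show "strict_mono_on {..<N} ?e"
    using assms by (intro strict_mono_onI) (auto intro!: sorted_wrt_nth_less[OF strict_sorted_list_of_set])
qed

lemma finite_sets_enumeration:
  fixes A :: "nat \<Rightarrow> int set"
  assumes "\<And>j. j \<in> D \<Longrightarrow> finite (A j) \<and> N \<le> card (A j)"
  obtains en :: "nat \<Rightarrow> nat \<Rightarrow> int"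
  where "\<And>j k. j \<in> D \<Longrightarrow> k < N \<Longrightarrow> en j k \<in> A j" and "\<And>j. j \<in> D \<Longrightarrow> strict_mono_on {..<N} (en j)"
proof -
  have "\<forall>j\<in>D. \<exists>en :: nat \<Rightarrow> int. (\<forall>k<N. en k \<in> A j) \<and> strict_mono_on {..<N} en"
    using assms finite_set_enumeration[of "A _" N] by metis
  then show ?thesis using that by metis
qed

text \<open>Replacing \<open>x i\<close> by 0 while raising every other coordinate by 1 would, if it always increased
  \<open>g\<close>, lead from the constant point \<open>card D\<close>, after one such step per coordinate, to a smaller
  point.\<close>

lemma exists_dominating_coordinate:
  fixes g :: "(nat \<Rightarrow> nat) \<Rightarrow> real"
  assumes "finite D" and "D \<noteq> {}"
    and mono: "\<And>x y. x \<in> Pi\<^sub>E D (\<lambda>_. {..2 * card D}) \<Longrightarrow> y \<in> Pi\<^sub>E D (\<lambda>_. {..2 * card D}) \<Longrightarrow>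
      (\<And>i. i \<in> D \<Longrightarrow> x i \<le> y i) \<Longrightarrow> g x \<le> g y"
  shows "\<exists>i\<in>D. \<exists>x\<in>Pi\<^sub>E D (\<lambda>_. {..2 * card D}). (\<forall>j\<in>D - {i}. x j < 2 * card D) \<and>
    g (\<lambda>j\<in>D. if j = i then 0 else Suc (x j)) \<le> g x"
proof (rule ccontr)
  assume neg: "\<not> ?thesis"
  define e where "e = card D"
  obtain h where h: "bij_betw h D {0..<e}" using ex_bij_betw_finite_nat[OF \<open>finite D\<close>] e_def by blast
  have "0 < e" using assms(1,2) e_def by (simp add: card_gt_0_iff)
  \<comment> \<open>After \<open>t\<close> moves, a coordinate with \<open>h j < t\<close> has been
    reset once and raised \<open>t - 1 - h j\<close> times since; the others have only been raised.
    At \<open>t = e\<close> each coordinate is below its starting value \<open>e\<close>.\<close>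
  define X where "X t = (\<lambda>j\<in>D. if h j < t then t - 1 - h j else e + t)" for t
  have X: "X t \<in> Pi\<^sub>E D (\<lambda>_. {..2 * e})" if "t \<le> e" for t
    using that by (auto simp: X_def)
  have step: "g (X t) < g (X (Suc t))" if te: "t < e" for t
  proof -
    obtain i where i: "i \<in> D" "h i = t" using h te unfolding bij_betw_def by (metis atLeastLessThan_iff imageE zero_le)
    have ne: "h j \<noteq> t" if "j \<in> D" "j \<noteq> i" for j
      using h i that by (auto simp: bij_betw_def dest: inj_onD)
    have "X (Suc t) = (\<lambda>j\<in>D. if j = i then 0 else Suc (X t j))"
    proof
      fix j show "X (Suc t) j = (\<lambda>j\<in>D. if j = i then 0 else Suc (X t j)) j"
        using ne[of j] i(2) by (auto simp: X_def)
    qed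
    moreover have "\<forall>j\<in>D - {i}. X t j < 2 * e" using te by (auto simp: X_def)
    moreover have "X t \<in> Pi\<^sub>E D (\<lambda>_. {..2 * e})" using X te by simp
    ultimately have "\<not> g (X (Suc t)) \<le> g (X t)" using neg i(1) unfolding e_def by force
    then show ?thesis by simp
  qed
  have "g (X 0) < g (X t)" if "0 < t" "t \<le> e" for t
    using that
  proof (induction t)
    case (Suc t)
    then show ?case using step[of t] by (cases "t = 0") auto
  qed simp
  then have "g (X 0) < g (X e)" using \<open>0 < e\<close> by simp
  moreover have "g (X e) \<le> g (X 0)"
  proof (rule mono)
    show "X e j \<le> X 0 j" if "j \<in> D" for j
    proof -
      have "h j < e" using h that by (auto simp: bij_betw_def)
      then show ?thesis using that by (simp add: X_def)
    qed
  qed (use X[of 0] X[of e] e_def in auto)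
  ultimately show False by simp
qed

text \<open>Each side is cut into \<open>b\<close> windows, and each window carries
  \<open>2 * card D + 1\<close> grid lines at distance \<open>K\<close>. On the grid of any window
  vector, \<open>exists_dominating_coordinate\<close> gives a coordinate \<open>i\<close> whose rise
  from the bottom of its window to line \<open>t i\<close> outweighs one grid step in all others.
  Keeping \<open>u\<close> windows of \<open>i\<close> with the same data elsewhere leaves, in every
  other coordinate, the \<open>K\<close> values between two consecutive lines.\<close>

lemma exists_leading_coordinate:
  assumes "finite D" and "D \<noteq> {}" and f: "monotone_pattern D D A f" and "1 \<le> K" and "1 \<le> u"
    and A: "\<And>i. i \<in> D \<Longrightarrow> finite (A i) \<and>
      (2 * card D * K + 1) * (card D * (2 * card D + 1) ^ card D * u) \<le> card (A i)"
  shows "\<exists>i\<in>D. \<exists>U\<subseteq>A i. \<exists>J\<in>sub_boxes (D - {i}) A (\<lambda>_. K). card U = u \<and>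
    (\<forall>x\<in>Pi\<^sub>E D (J(i := U)). \<forall>y\<in>Pi\<^sub>E D (J(i := U)). x i < y i \<longrightarrow> f x < f y)"
proof -
  define e where "e = card D"
  define S where "S = 2 * e * K + 1"
  \<comment> \<open>There are \<open>b ^ e\<close> window vectors and
    \<open>e * (2 * e + 1) ^ e * b ^ (e - 1)\<close> keys, since a key omits the window of
    \<open>i\<close>; with this \<open>b\<close> the quotient is exactly \<open>u\<close>.\<close>
  define b where "b = e * (2 * e + 1) ^ e * u"
  have "0 < e" using assms(1,2) e_def by (simp add: card_gt_0_iff)
  have "0 < S" by (simp add: S_def)
  have "0 < b" using \<open>0 < e\<close> \<open>1 \<le> u\<close> by (simp add: b_def)
  obtain en :: "nat \<Rightarrow> nat \<Rightarrow> int" where en: "\<And>j k. j \<in> D \<Longrightarrow> k < S * b \<Longrightarrow> en j k \<in> A j"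
    and en_mono: "\<And>j. j \<in> D \<Longrightarrow> strict_mono_on {..<S * b} (en j)"
    using finite_sets_enumeration[of D A "S * b"] A unfolding S_def b_def e_def by blast
  have en_less: "en j k < en j l \<longleftrightarrow> k < l" if "j \<in> D" "k < S * b" "l < S * b" for j k l
    using en_mono[OF that(1)] that(2,3) by (simp add: strict_mono_on_less)
  have en_le: "en j k \<le> en j l" if "j \<in> D" "k \<le> l" "l < S * b" for j k l
    using en_less[OF that(1), of l k] that(2,3) by (simp add: not_less[symmetric])
  define pt where "pt w t = (\<lambda>j\<in>D. en j (w j * S + t j * K))" for w t :: "nat \<Rightarrow> nat"
  have index: "c * S + k < S * b" if "c < b" "k \<le> 2 * e * K" for c k
  proof -
    have "c * S + k < Suc c * S" using that(2) by (simp add: S_def)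
    also have "\<dots> \<le> b * S" using that(1) by (intro mult_le_mono1) simp
    finally show ?thesis by (simp add: mult.commute)
  qed
  have tK: "t * K \<le> 2 * e * K" if "t \<le> 2 * e" for t using that by (rule mult_le_mono1)
  define G where "G = Pi\<^sub>E D (\<lambda>_. {..2 * e})"
  define W where "W = Pi\<^sub>E D (\<lambda>_. {..<b})"
  have pt: "pt w t \<in> Pi\<^sub>E D A" if "\<And>j. j \<in> D \<Longrightarrow> w j < b \<and> t j \<le> 2 * e" for w t
    unfolding pt_def using en index tK that by auto
  have GD: "t j \<le> 2 * e" if "t \<in> G" "j \<in> D" for t j using that by (auto simp: G_def)
  have WD: "w j < b" if "w \<in> W" "j \<in> D" for w j using that by (auto simp: W_def)
  have finW: "finite W" unfolding W_def using \<open>finite D\<close> by (intro finite_PiE) auto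
  have cardW: "card W = b ^ e" unfolding W_def e_def using \<open>finite D\<close> by (simp add: card_PiE)
  define elim where "elim i t = (\<lambda>j\<in>D. if j = i then 0 else Suc (t j))" for i and t :: "nat \<Rightarrow> nat"
  define keys where "keys = Sigma D (\<lambda>i. G \<times> Pi\<^sub>E (D - {i}) (\<lambda>_. {..<b}))"
  define good where "good w \<kappa> = (case \<kappa> of (i, t, v) \<Rightarrow> restrict w (D - {i}) = v \<and>
      (\<forall>j\<in>D - {i}. t j < 2 * e) \<and> f (pt w (elim i t)) \<le> f (pt w t))" for w and \<kappa> :: "nat \<times> (nat \<Rightarrow> nat) \<times> (nat \<Rightarrow> nat)"
  have fink: "finite keys"
    unfolding keys_def G_def using \<open>finite D\<close> by (intro finite_SigmaI finite_cartesian_product finite_PiE) auto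
  have "card (G \<times> Pi\<^sub>E (D - {i}) (\<lambda>_. {..<b})) = (2 * e + 1) ^ e * b ^ (e - 1)" if "i \<in> D" for i
    unfolding G_def e_def using \<open>finite D\<close> that by (simp add: card_cartesian_product card_PiE)
  then have cardk: "card keys = e * ((2 * e + 1) ^ e * b ^ (e - 1))"
    unfolding keys_def using \<open>finite D\<close> fink e_def
    by (subst card_SigmaI) (auto simp: G_def intro!: finite_cartesian_product finite_PiE)
  have "\<exists>\<kappa>\<in>keys. \<exists>W'\<subseteq>W. card W' = u \<and> (\<forall>w\<in>W'. good w \<kappa>)"
  proof (rule pigeonhole_relation[OF fink finW])
    show "W \<noteq> {}" using cardW \<open>0 < b\<close> by auto
    have "card keys * u = b * b ^ (e - 1)" by (simp add: cardk b_def algebra_simps)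
    also have "\<dots> = card W" using cardW \<open>0 < e\<close> by (simp add: power_eq_if)
    finally show "card keys * u \<le> card W" by simp
    show "\<exists>\<kappa>\<in>keys. good w \<kappa>" if "w \<in> W" for w
    proof -
      have "\<exists>i\<in>D. \<exists>t\<in>Pi\<^sub>E D (\<lambda>_. {..2 * card D}). (\<forall>j\<in>D - {i}. t j < 2 * card D) \<and>
          f (pt w (\<lambda>j\<in>D. if j = i then 0 else Suc (t j))) \<le> f (pt w t)"
      proof (rule exists_dominating_coordinate[OF assms(1,2)])
        fix s t :: "nat \<Rightarrow> nat"
        assume st: "s \<in> Pi\<^sub>E D (\<lambda>_. {..2 * card D})" "t \<in> Pi\<^sub>E D (\<lambda>_. {..2 * card D})" "\<And>i. i \<in> D \<Longrightarrow> s i \<le> t i"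
        have s: "s j \<le> 2 * e" and t: "t j \<le> 2 * e" if "j \<in> D" for j
          using st that by (auto simp: e_def)
        show "f (pt w s) \<le> f (pt w t)"
        proof (rule increasing_le[OF f \<open>finite D\<close>])
          show "pt w s i \<le> pt w t i" if "i \<in> D" for i
            using that WD[OF \<open>w \<in> W\<close> that] st(3) tK[OF t[OF that]]
            by (auto simp: pt_def intro!: en_le index)
        qed (use pt s t WD[OF \<open>w \<in> W\<close>] in auto)
      qed
      then obtain i t where it: "i \<in> D" "t \<in> G" "\<forall>j\<in>D - {i}. t j < 2 * e" "f (pt w (elim i t)) \<le> f (pt w t)"
        unfolding elim_def G_def e_def by blast
      moreover have "restrict w (D - {i}) \<in> Pi\<^sub>E (D - {i}) (\<lambda>_. {..<b})" using WD[OF \<open>w \<in> W\<close>] by auto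
      ultimately show ?thesis
        by (intro bexI[of _ "(i, t, restrict w (D - {i}))"]) (auto simp: good_def keys_def)
    qed
  qed
  then obtain i t v W' where i: "i \<in> D" and tG: "t \<in> G" and W': "W' \<subseteq> W" "card W' = u"
    and good: "\<And>w. w \<in> W' \<Longrightarrow> good w (i, t, v)"
    and v: "v \<in> Pi\<^sub>E (D - {i}) (\<lambda>_. {..<b})"
    unfolding keys_def by (elim bexE exE conjE SigmaE) (metis mem_Sigma_iff)
  have wv: "w j = v j" if "w \<in> W'" "j \<in> D" "j \<noteq> i" for w j
  proof -
    have "restrict w (D - {i}) = v" using good[OF that(1)] by (simp add: good_def)
    then show ?thesis using that by (metis DiffI restrict_apply' singletonD)
  qed
  have vb: "v j < b" if "j \<in> D" "j \<noteq> i" for j using v that by auto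
  define pos where "pos w = en i (w i * S + t i * K)" for w :: "nat \<Rightarrow> nat"
  define U where "U = pos ` W'"
  define J where "J = (\<lambda>j\<in>D - {i}. en j ` {v j * S + t j * K..<v j * S + t j * K + K})"
  have t_lt: "t j < 2 * e" if "j \<in> D" "j \<noteq> i" for j
  proof -
    obtain w where "w \<in> W'" using W'(2) \<open>1 \<le> u\<close> by fastforce
    then show ?thesis using good[of w] that by (simp add: good_def)
  qed
  have idx: "v j * S + t j * K + r < S * b" if "j \<in> D" "j \<noteq> i" "r \<le> K" for j r
  proof -
    have "t j * K + r \<le> Suc (t j) * K" using that(3) by simp
    also have "\<dots> \<le> 2 * e * K" using t_lt[OF that(1,2)] by (intro mult_le_mono1) simp
    finally show ?thesis using index[OF vb[OF that(1,2)]] by (metis add.assoc)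
  qed
  have idi: "w i * S + t i * K < S * b" if "w \<in> W'" for w
    using index[OF WD] tK[OF GD[OF tG i]] W'(1) that i by blast
  \<comment> \<open>Vectors in \<open>W'\<close> agree off \<open>i\<close>, so the window of
    \<open>i\<close> identifies them.\<close>
  have inj: "inj_on pos W'"
  proof (rule inj_onI)
    fix w w' assume w: "w \<in> W'" "w' \<in> W'" "pos w = pos w'"
    have "w i * S + t i * K = w' i * S + t i * K"
      using w en_less[OF i idi[OF w(1)] idi[OF w(2)]] en_less[OF i idi[OF w(2)] idi[OF w(1)]]
      unfolding pos_def by (metis less_irrefl linorder_neqE_nat)
    then have "w i = w' i" using \<open>0 < S\<close> by simp
    show "w = w'"
    proof (rule PiE_ext)
      show "w \<in> Pi\<^sub>E D (\<lambda>_. {..<b})" "w' \<in> Pi\<^sub>E D (\<lambda>_. {..<b})" using w W'(1) W_def by auto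
      show "w j = w' j" if "j \<in> D" for j
        using wv[OF w(1) that] wv[OF w(2) that] \<open>w i = w' i\<close> by (cases "j = i") auto
    qed
  qed
  have "card U = u" unfolding U_def using card_image[OF inj] W'(2) by simp
  moreover have UA: "U \<subseteq> A i" unfolding U_def pos_def using en[OF i] idi by auto
  moreover have "J \<in> sub_boxes (D - {i}) A (\<lambda>_. K)"
    unfolding sub_boxes_def
  proof (rule PiE_I)
    fix j assume j: "j \<in> D - {i}"
    have "inj_on (en j) {v j * S + t j * K..<v j * S + t j * K + K}"
    proof (rule inj_on_subset)
      show "inj_on (en j) {..<S * b}" using en_mono j by (meson DiffD1 strict_mono_on_imp_inj_on)
      show "{v j * S + t j * K..<v j * S + t j * K + K} \<subseteq> {..<S * b}"
        using idx[of j K] j by auto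
    qed
    moreover have "k < S * b" if "k < v j * S + t j * K + K" for k
      using idx[of j K] j that by auto
    ultimately show "J j \<in> {T. T \<subseteq> A j \<and> card T = K}"
      using j en[of j] by (auto simp: J_def card_image)
  qed (auto simp: J_def)
  moreover have "f x < f y"
    if x: "x \<in> Pi\<^sub>E D (J(i := U))" and y: "y \<in> Pi\<^sub>E D (J(i := U))" and less: "x i < y i" for x y
  proof -
    have "x i \<in> U" "y i \<in> U" using x y i by (auto dest: PiE_mem)
    then obtain w w' where w: "w \<in> W'" "x i = pos w" and w': "w' \<in> W'" "y i = pos w'"
      unfolding U_def by blast
    have "w i * S + t i * K < w' i * S + t i * K"
      using less w w' en_less[OF i idi[OF w(1)] idi[OF w'(1)]] unfolding pos_def by simp
    then have "w i < w' i" by simp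
    have wb: "w j < b" "w' j < b" if "j \<in> D" for j using w(1) w'(1) W'(1) WD that by auto
    \<comment> \<open>\<open>t'\<close> keeps the position of \<open>x i\<close> and lifts every
      other coordinate to the grid line just above its values in \<open>J j\<close>.\<close>
    define t' where "t' = (\<lambda>j\<in>D. if j = i then t i else Suc (t j))"
    have Jj: "\<exists>r<K. z j = en j (v j * S + t j * K + r)"
      if z: "z \<in> Pi\<^sub>E D (J(i := U))" and j: "j \<in> D" "j \<noteq> i" for z j
    proof -
      have "z j \<in> J j" using PiE_mem[OF z j(1)] j(2) by simp
      then obtain k where k: "v j * S + t j * K \<le> k" "k < v j * S + t j * K + K" "z j = en j k"
        using j by (auto simp: J_def)
      then show ?thesis by (intro exI[of _ "k - (v j * S + t j * K)"]) auto
    qed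
    have inA: "Pi\<^sub>E D (J(i := U)) \<subseteq> Pi\<^sub>E D A"
    proof (rule PiE_mono)
      show "(J(i := U)) j \<subseteq> A j" if "j \<in> D" for j
        using UA sub_boxesD[OF \<open>J \<in> sub_boxes (D - {i}) A (\<lambda>_. K)\<close>, of j] that by auto
    qed
    have ptA: "pt w t' \<in> Pi\<^sub>E D A" "pt w' (elim i t) \<in> Pi\<^sub>E D A" "pt w' t \<in> Pi\<^sub>E D A"
      using wb GD[OF tG] t_lt by (auto intro!: pt simp: t'_def elim_def Suc_le_eq)
    \<comment> \<open>The others are raised to the next grid line, \<open>i\<close> moves to the
      bottom of the later window, and \<open>good\<close> trades the raised coordinates for the rise
      of \<open>i\<close> inside that window, which ends below \<open>y\<close>.\<close>
    have "f x \<le> f (pt w t')"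
    proof (rule increasing_le[OF f \<open>finite D\<close> _ ptA(1)])
      show "x \<in> Pi\<^sub>E D A" using x inA by blast
      show "x j \<le> pt w t' j" if jD: "j \<in> D" for j
      proof (cases "j = i")
        case True
        then show ?thesis using w(2) i by (simp add: pt_def t'_def pos_def)
      next
        case False
        then obtain r where "r < K" "x j = en j (v j * S + t j * K + r)" using Jj[OF x jD] False by blast
        then show ?thesis
          using False that wv[OF w(1) that False] idx[OF that False, of K]
          by (auto simp: pt_def t'_def algebra_simps intro!: en_le)
      qed
    qed
    also have "\<dots> < f (pt w' (elim i t))"
    proof (rule increasing_less[OF f \<open>finite D\<close> ptA(1,2) _ i])
      \<comment> \<open>The \<open>+ 1\<close> in \<open>S\<close> puts even the top line of a
        window below the bottom of the next one.\<close>
      have "w i * S + t i * K < Suc (w i) * S" 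
        using le_imp_less_Suc[OF tK[OF GD[OF tG i]]] by (simp only: S_def mult_Suc)
      also have "\<dots> \<le> w' i * S" using \<open>w i < w' i\<close> by (intro mult_le_mono1) simp
      finally show less_i: "pt w t' i < pt w' (elim i t) i"
        using i idi[OF w(1)] index[OF wb(2)[OF i], of 0] en_less[OF i]
        by (auto simp: pt_def t'_def elim_def)
      show "pt w t' j \<le> pt w' (elim i t) j" if "j \<in> D" for j
        using less_i wv[OF w(1) that] wv[OF w'(1) that] that
        by (cases "j = i") (auto simp: pt_def t'_def elim_def)
    qed
    also have "\<dots> \<le> f (pt w' t)" using good[OF w'(1)] by (simp add: good_def)
    also have "\<dots> \<le> f y"
    proof (rule increasing_le[OF f \<open>finite D\<close> ptA(3)])
      show "y \<in> Pi\<^sub>E D A" using y inA by blast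
      show "pt w' t j \<le> y j" if jD: "j \<in> D" for j
      proof (cases "j = i")
        case True
        then show ?thesis using w'(2) i by (simp add: pt_def pos_def)
      next
        case False
        then obtain r where "r < K" "y j = en j (v j * S + t j * K + r)" using Jj[OF y jD] False by blast
        then show ?thesis
          using False that wv[OF w'(1) that False] idx[OF that False, of r]
          by (auto simp: pt_def intro!: en_le)
      qed
    qed
    finally show ?thesis .
  qed
  ultimately show ?thesis using i by blast
qed

section \<open>From increasing to lexicographic arrays\<close>

text \<open>Points lose the index \<open>i\<close> in the recursive call, and the function puts the
  value \<open>a\<close> back; so the box can be passed on unchanged.\<close>

fun lex_increasing :: "nat list \<Rightarrow> (nat \<Rightarrow> int set) \<Rightarrow> ((nat \<Rightarrow> int) \<Rightarrow> real) \<Rightarrow> bool" where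
  "lex_increasing [] A f \<longleftrightarrow> True"
| "lex_increasing (i # is) A f \<longleftrightarrow>
     (\<forall>x\<in>Pi\<^sub>E (insert i (set is)) A. \<forall>y\<in>Pi\<^sub>E (insert i (set is)) A. x i < y i \<longrightarrow> f x < f y) \<and>
     (\<forall>a\<in>A i. lex_increasing is A (\<lambda>x. f (x(i := a))))"

lemma lex_increasing_cong:
  "(\<And>i. i \<in> set is \<Longrightarrow> A i = B i) \<Longrightarrow> lex_increasing is A f = lex_increasing is B f"
proof (induction "is" arbitrary: f)
  case (Cons i "is")
  have "Pi\<^sub>E (insert i (set is)) A = Pi\<^sub>E (insert i (set is)) B" using Cons.prems by (intro PiE_cong) auto
  then show ?case using Cons by simp
qed simp

definition forces_lex :: "nat \<Rightarrow> nat \<Rightarrow> nat \<Rightarrow> bool" where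
  "forces_lex d n K \<longleftrightarrow>
     (\<forall>D A f. finite D \<and> card D = d \<and> (\<forall>i\<in>D. finite (A i) \<and> K \<le> card (A i)) \<and>
        monotone_pattern D D A f \<longrightarrow>
        (\<exists>B\<in>sub_boxes D A (\<lambda>_. n). \<exists>is. distinct is \<and> set is = D \<and> lex_increasing is B f))"

lemma forces_lex_mono: "forces_lex d n K \<Longrightarrow> K \<le> K' \<Longrightarrow> forces_lex d n K'"
  unfolding forces_lex_def
proof (intro allI impI, elim conjE)
  fix D A and f :: "(nat \<Rightarrow> int) \<Rightarrow> real"
  assume *: "\<forall>D A f. finite D \<and> card D = d \<and> (\<forall>i\<in>D. finite (A i) \<and> K \<le> card (A i)) \<and>
      monotone_pattern D D A f \<longrightarrow>
      (\<exists>B\<in>sub_boxes D A (\<lambda>_. n). \<exists>is. distinct is \<and> set is = D \<and> lex_increasing is B f)"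
    and "K \<le> K'" "\<forall>i\<in>D. finite (A i) \<and> K' \<le> card (A i)"
    and D: "finite D" "card D = d" "monotone_pattern D D A f"
  then have "\<forall>i\<in>D. finite (A i) \<and> K \<le> card (A i)" using le_trans by blast
  then show "\<exists>B\<in>sub_boxes D A (\<lambda>_. n). \<exists>is. distinct is \<and> set is = D \<and> lex_increasing is B f"
    using * D by blast
qed

text \<open>A leading coordinate can be put in front only if all slices over \<open>U'\<close> share
  the box \<open>B\<close> and the order \<open>is\<close>; this common choice is what has to be
  paid for below.\<close>

lemma lex_increasing_Cons:
  assumes i: "i \<in> D" and J: "J \<in> sub_boxes (D - {i}) A q" and U: "U \<subseteq> A i"
    and lead: "\<forall>x\<in>Pi\<^sub>E D (J(i := U)). \<forall>y\<in>Pi\<^sub>E D (J(i := U)). x i < y i \<longrightarrow> f x < f y"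
    and U': "U' \<subseteq> U" "card U' = n"
    and B: "B \<in> sub_boxes (D - {i}) J (\<lambda>_. n)" and "is": "set is = D - {i}"
    and lex: "\<And>z. z \<in> U' \<Longrightarrow> lex_increasing is B (\<lambda>x. f (x(i := z)))"
  shows "B(i := U') \<in> sub_boxes D A (\<lambda>_. n) \<and> lex_increasing (i # is) (B(i := U')) f"
proof
  have D: "insert i (D - {i}) = D" using i by blast
  show "B(i := U') \<in> sub_boxes D A (\<lambda>_. n)"
    using sub_boxes_insert[OF sub_boxes_trans[OF J B], of U' i] U U' D by auto
  have sub: "Pi\<^sub>E D (B(i := U')) \<subseteq> Pi\<^sub>E D (J(i := U))"
  proof (rule PiE_mono)
    show "(B(i := U')) j \<subseteq> (J(i := U)) j" if "j \<in> D" for j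
      using sub_boxesD[OF B, of j] U'(1) that by auto
  qed
  have "lex_increasing is (B(i := U')) g = lex_increasing is B g" for g
    using "is" by (intro lex_increasing_cong) auto
  moreover have "\<forall>x\<in>Pi\<^sub>E D (B(i := U')). \<forall>y\<in>Pi\<^sub>E D (B(i := U')). x i < y i \<longrightarrow> f x < f y"
    using lead sub by blast
  ultimately show "lex_increasing (i # is) (B(i := U')) f"
    using lex "is" D by simp
qed

text \<open>The key of a slice is the box and the order in which it becomes lexicographic. As the
  sides of \<open>J\<close> have size \<open>K\<close> whatever \<open>u\<close> is,
  \<open>u\<close> can be chosen after the number of keys is known.\<close>

lemma forces_lex_Suc:
  assumes "forces_lex d n K" and "1 \<le> K" and "1 \<le> n"
  shows "forces_lex (Suc d) n
    ((2 * Suc d * K + 1) * (Suc d * (2 * Suc d + 1) ^ Suc d * ((K choose n) ^ d * d ^ d * n + 1)))"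
  unfolding forces_lex_def
proof (intro allI impI, elim conjE)
  fix D A and f :: "(nat \<Rightarrow> int) \<Rightarrow> real"
  assume D: "finite D" "card D = Suc d" and f: "monotone_pattern D D A f"
    and A: "\<forall>i\<in>D. finite (A i) \<and> (2 * Suc d * K + 1) *
      (Suc d * (2 * Suc d + 1) ^ Suc d * ((K choose n) ^ d * d ^ d * n + 1)) \<le> card (A i)"
  have "D \<noteq> {}" using D by auto
  \<comment> \<open>\<open>d ^ d\<close> counts all lists of length \<open>d\<close> over the
    remaining coordinates; the \<open>+ 1\<close> makes \<open>U\<close> non-empty without any lower
    bound on \<open>K choose n\<close>.\<close>
  define u where "u = (K choose n) ^ d * d ^ d * n + 1"
  have "\<exists>i\<in>D. \<exists>U\<subseteq>A i. \<exists>J\<in>sub_boxes (D - {i}) A (\<lambda>_. K). card U = u \<and>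
    (\<forall>x\<in>Pi\<^sub>E D (J(i := U)). \<forall>y\<in>Pi\<^sub>E D (J(i := U)). x i < y i \<longrightarrow> f x < f y)"
    using A D(2) by (intro exists_leading_coordinate[OF D(1) \<open>D \<noteq> {}\<close> f \<open>1 \<le> K\<close>]) (auto simp: u_def)
  then obtain i U J where i: "i \<in> D" and U: "U \<subseteq> A i" "card U = u"
    and J: "J \<in> sub_boxes (D - {i}) A (\<lambda>_. K)"
    and lead: "\<forall>x\<in>Pi\<^sub>E D (J(i := U)). \<forall>y\<in>Pi\<^sub>E D (J(i := U)). x i < y i \<longrightarrow> f x < f y"
    by blast
  have finJ: "finite (J j)" "card (J j) = K" if "j \<in> D - {i}" for j
    using sub_boxesD[OF J that] A that finite_subset by auto
  define keys where "keys = sub_boxes (D - {i}) J (\<lambda>_. n) \<times> {is. set is \<subseteq> D - {i} \<and> length is = d}"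
  have fink: "finite keys" unfolding keys_def
    using finite_sub_boxes[of "D - {i}" J] finJ D(1) finite_lists_length_eq[of "D - {i}" d] by auto
  have "card (D - {i}) = d" using D i by simp
  moreover have "card (sub_boxes (D - {i}) J (\<lambda>_. n)) = (\<Prod>j\<in>D - {i}. K choose n)"
    using card_sub_boxes[of "D - {i}" J "\<lambda>_. n"] finJ D(1) by simp
  ultimately have cardk: "card keys = (K choose n) ^ d * d ^ d"
    unfolding keys_def using D(1) by (simp add: card_cartesian_product card_lists_length_eq)
  have "\<exists>\<kappa>\<in>keys. \<exists>U'\<subseteq>U. card U' = n \<and> (\<forall>z\<in>U'. distinct (snd \<kappa>) \<and> set (snd \<kappa>) = D - {i} \<and>
      lex_increasing (snd \<kappa>) (fst \<kappa>) (\<lambda>x. f (x(i := z))))"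
  proof (rule pigeonhole_relation[OF fink])
    show "finite U" using U(1) A i finite_subset by blast
    show "U \<noteq> {}" using U(2) u_def by auto
    show "card keys * n \<le> card U" using cardk U(2) u_def by simp
    fix z assume "z \<in> U"
    have "monotone_pattern D (D - {i}) J (\<lambda>x. f (x(i := z)))"
      using monotone_pattern_subset[OF monotone_pattern_slice[OF f i]] \<open>z \<in> U\<close> U(1) sub_boxesD[OF J] by blast
    \<comment> \<open>The pattern is consulted only at indices of \<open>D - {i}\<close>.\<close>
    then have "monotone_pattern (D - {i}) (D - {i}) J (\<lambda>x. f (x(i := z)))"
      by (simp add: monotone_pattern_def)
    then have "\<exists>B\<in>sub_boxes (D - {i}) J (\<lambda>_. n). \<exists>is. distinct is \<and> set is = D - {i} \<and>
        lex_increasing is B (\<lambda>x. f (x(i := z)))"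
      using assms(1)[unfolded forces_lex_def, rule_format, of "D - {i}" J] D i finJ by auto
    then obtain B "is" where *: "B \<in> sub_boxes (D - {i}) J (\<lambda>_. n)" "distinct is" "set is = D - {i}"
        "lex_increasing is B (\<lambda>x. f (x(i := z)))" by blast
    moreover have "length is = d" using * D i by (metis card_Diff_singleton diff_Suc_1 distinct_card)
    ultimately show "\<exists>\<kappa>\<in>keys. distinct (snd \<kappa>) \<and> set (snd \<kappa>) = D - {i} \<and>
        lex_increasing (snd \<kappa>) (fst \<kappa>) (\<lambda>x. f (x(i := z)))"
      unfolding keys_def by (intro bexI[of _ "(B, is)"]) auto
  qed
  then obtain B "is" U' where B: "B \<in> sub_boxes (D - {i}) J (\<lambda>_. n)" and U': "U' \<subseteq> U" "card U' = n"
    and lex: "\<forall>z\<in>U'. distinct is \<and> set is = D - {i} \<and> lex_increasing is B (\<lambda>x. f (x(i := z)))"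
    unfolding keys_def by auto
  obtain z where "z \<in> U'" using U'(2) \<open>1 \<le> n\<close> by fastforce
  then have "is": "distinct is" "set is = D - {i}" using lex by auto
  have "B(i := U') \<in> sub_boxes D A (\<lambda>_. n) \<and> lex_increasing (i # is) (B(i := U')) f"
    using lex_increasing_Cons[OF i J U(1) lead U' B "is"(2)] lex by blast
  moreover have "distinct (i # is)" "set (i # is) = D" using "is" i by auto
  ultimately show "\<exists>B\<in>sub_boxes D A (\<lambda>_. n). \<exists>is. distinct is \<and> set is = D \<and> lex_increasing is B f"
    by blast
qed

lemma forces_lex_1: "forces_lex 1 n n"
  unfolding forces_lex_def
proof (intro allI impI, elim conjE)
  fix D A and f :: "(nat \<Rightarrow> int) \<Rightarrow> real"
  assume "finite D" "card D = 1" and A: "\<forall>i\<in>D. finite (A i) \<and> n \<le> card (A i)"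
    and f: "monotone_pattern D D A f"
  then obtain i where D: "D = {i}" using card_1_singletonE by blast
  obtain B where B: "B \<in> sub_boxes D A (\<lambda>_. n)" using A exists_sub_box[of D "\<lambda>_. n" A] by blast
  have "lex_increasing [i] B f"
    using increasing_less[OF monotone_pattern_subset[OF f, of B], of _ _ i] sub_boxesD[OF B] D by auto
  then show "\<exists>B\<in>sub_boxes D A (\<lambda>_. n). \<exists>is. distinct is \<and> set is = D \<and> lex_increasing is B f"
    using B D by (intro bexI[of _ B] exI[of _ "[i]"]) auto
qed

text \<open>In the grid of \<open>p \<times> p\<close> blocks with side \<open>n\<close>, every block is dominated by one of
  its two coordinates; so one coordinate dominates half of the blocks in some row or column.\<close>

lemma exists_half_dominated_line:
  fixes g :: "nat \<Rightarrow> nat \<Rightarrow> real"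
  assumes "1 \<le> p"
  shows "\<exists>I<p. \<exists>S\<subseteq>{..<p}. p \<le> 2 * card S \<and>
    ((\<forall>w\<in>S. g (w * n) (I * n + n - 1) \<le> g (w * n + n - 1) (I * n)) \<or>
     (\<forall>w\<in>S. g (I * n + n - 1) (w * n) \<le> g (I * n) (w * n + n - 1)))"
proof (rule ccontr)
  define R where "R w v \<longleftrightarrow> g (w * n) (v * n + n - 1) \<le> g (w * n + n - 1) (v * n)" for w v
  assume neg: "\<not> ?thesis"
  have 1: "2 * card {w\<in>{..<p}. R w v} < p" if "v < p" for v
  proof (rule ccontr)
    assume "\<not> 2 * card {w\<in>{..<p}. R w v} < p"
    then show False using neg that
      by (auto simp: R_def dest!: spec[of _ v] spec[of _ "{w\<in>{..<p}. R w v}"])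
  qed
  have 2: "2 * card {v\<in>{..<p}. \<not> R w v} < p" if "w < p" for w
  proof (rule ccontr)
    assume "\<not> 2 * card {v\<in>{..<p}. \<not> R w v} < p"
    then show False using neg that
      by (auto simp: R_def dest!: spec[of _ w] spec[of _ "{v\<in>{..<p}. \<not> R w v}"])
  qed
  \<comment> \<open>Every block is counted once, at its \<open>v\<close> if \<open>R w v\<close>
    holds and at its \<open>w\<close> otherwise; if all these counts were below
    \<open>p / 2\<close>, fewer than \<open>p * p\<close> blocks would be counted.\<close>
  have "p * p = (\<Sum>w<p. \<Sum>v<p. (1::nat))" by simp
  also have "\<dots> = (\<Sum>w<p. \<Sum>v<p. of_bool (R w v) + of_bool (\<not> R w v))"
    by (intro sum.cong) auto
  also have "\<dots> = (\<Sum>v<p. \<Sum>w<p. of_bool (R w v)) + (\<Sum>w<p. \<Sum>v<p. of_bool (\<not> R w v))"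
    unfolding sum.distrib by (subst sum.swap) (rule refl)
  also have "\<dots> = (\<Sum>v<p. card {w\<in>{..<p}. R w v}) + (\<Sum>w<p. card {v\<in>{..<p}. \<not> R w v})"
    by (simp add: of_bool_def sum.If_cases Int_def)
  finally have "2 * (p * p) = (\<Sum>v<p. 2 * card {w\<in>{..<p}. R w v}) + (\<Sum>w<p. 2 * card {v\<in>{..<p}. \<not> R w v})"
    by (simp add: sum_distrib_left)
  also have "\<dots> < (\<Sum>v<p. p) + (\<Sum>w<p. p)"
    using 1 2 assms by (intro add_strict_mono sum_strict_mono) auto
  finally show False by simp
qed

text \<open>Greedy selection: some point lies in at least the average fraction \<open>h / p\<close> of the
  remaining sets.\<close>

lemma exists_common_subset:
  assumes "finite Z" and "finite W" and "card W \<le> p" and "1 \<le> m"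
    and S: "\<And>z. z \<in> Z \<Longrightarrow> S z \<subseteq> W \<and> n + h \<le> card (S z)"
    and card: "m * p ^ n \<le> card Z * h ^ n" and "1 \<le> p"
  shows "\<exists>T\<subseteq>W. card T = n \<and> (\<exists>Z'\<subseteq>Z. card Z' = m \<and> (\<forall>z\<in>Z'. T \<subseteq> S z))"
  using assms(1,2,3) S card
proof (induction n arbitrary: Z W S)
  case 0
  then obtain Z' where "Z' \<subseteq> Z" "card Z' = m" by (metis mult.right_neutral obtain_subset_with_card_n power_0)
  then show ?case by (intro exI[of _ "{}"]) auto
next
  case (Suc n)
  have "0 < m * p ^ Suc n" using \<open>1 \<le> m\<close> \<open>1 \<le> p\<close> by simp
  then have "Z \<noteq> {}" using Suc.prems(5) by auto
  have "\<exists>w\<in>W. card Z * h \<le> p * card {z\<in>Z. w \<in> S z}"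
  proof (rule ccontr)
    assume neg: "\<not> ?thesis"
    have "W \<noteq> {}" using Suc.prems(4) \<open>Z \<noteq> {}\<close> by fastforce
    have "p * (card Z * (Suc n + h)) = p * (\<Sum>z\<in>Z. Suc n + h)" by simp
    also have "\<dots> \<le> p * (\<Sum>z\<in>Z. card (S z))" using Suc.prems(4) by (intro mult_le_mono2 sum_mono) auto
    also have "(\<Sum>z\<in>Z. card (S z)) = (\<Sum>z\<in>Z. \<Sum>w\<in>W. of_bool (w \<in> S z))"
    proof (rule sum.cong)
      fix z assume "z \<in> Z"
      then have "W \<inter> S z = S z" using Suc.prems(4) by blast
      then show "card (S z) = (\<Sum>w\<in>W. of_bool (w \<in> S z))"
        using Suc.prems(2) by (simp add: of_bool_def sum.If_cases)
    qed simp
    also have "\<dots> = (\<Sum>w\<in>W. \<Sum>z\<in>Z. of_bool (w \<in> S z))" by (rule sum.swap)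
    also have "\<dots> = (\<Sum>w\<in>W. card {z\<in>Z. w \<in> S z})"
      using Suc.prems(1) by (simp add: of_bool_def sum.If_cases Int_def)
    also have "p * \<dots> = (\<Sum>w\<in>W. p * card {z\<in>Z. w \<in> S z})" by (simp add: sum_distrib_left)
    also have "\<dots> < (\<Sum>w\<in>W. card Z * h)"
      using neg \<open>W \<noteq> {}\<close> Suc.prems(2) by (intro sum_strict_mono) auto
    also have "\<dots> \<le> p * (card Z * h)" using Suc.prems(3) by simp
    finally have "card Z * (Suc n + h) < card Z * h" by (simp only: mult_less_cancel1)
    moreover have "card Z * h \<le> card Z * (Suc n + h)" by (rule mult_le_mono2) simp
    ultimately show False by linarith
  qed
  then obtain w where w: "w \<in> W" "card Z * h \<le> p * card {z\<in>Z. w \<in> S z}" by blast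
  \<comment> \<open>Each choice uses up one element of every remaining set; the reserve
    \<open>h\<close> keeps the average fraction at \<open>h / p\<close> until the last
    choice.\<close>
  have "\<exists>T\<subseteq>W - {w}. card T = n \<and> (\<exists>Z'\<subseteq>{z\<in>Z. w \<in> S z}. card Z' = m \<and> (\<forall>z\<in>Z'. T \<subseteq> S z - {w}))"
  proof (rule Suc.IH)
    show "S z - {w} \<subseteq> W - {w} \<and> n + h \<le> card (S z - {w})" if "z \<in> {z\<in>Z. w \<in> S z}" for z
      using that Suc.prems(4)[of z] Suc.prems(2) by (auto simp: card_Diff_singleton)
    have "p * (m * p ^ n) \<le> (card Z * h) * h ^ n" using Suc.prems(5) by (simp add: algebra_simps)
    also have "\<dots> \<le> (p * card {z\<in>Z. w \<in> S z}) * h ^ n" using w(2) by (rule mult_le_mono1)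
    finally show "m * p ^ n \<le> card {z\<in>Z. w \<in> S z} * h ^ n" using \<open>1 \<le> p\<close> by (simp add: mult.assoc)
    show "card (W - {w}) \<le> p" by (rule le_trans[OF card_Diff1_le Suc.prems(3)])
  qed (use Suc.prems(1,2) in auto)
  then obtain T Z' where T: "T \<subseteq> W - {w}" "card T = n" "Z' \<subseteq> {z\<in>Z. w \<in> S z}" "card Z' = m"
    "\<forall>z\<in>Z'. T \<subseteq> S z - {w}" by blast
  have "finite T" using T(1) Suc.prems(2) finite_subset by blast
  moreover have "w \<notin> T" using T(1) by blast
  ultimately have "card (insert w T) = Suc n" using T(2) by simp
  moreover have "insert w T \<subseteq> W" using T(1) w(1) by blast
  moreover have "Z' \<subseteq> Z" "\<forall>z\<in>Z'. insert w T \<subseteq> S z" using T(3,5) by auto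
  ultimately show ?case using T(4) by blast
qed

section \<open>Two coordinates: a dominated line of blocks gives lexicographic order\<close>

definition pair_point :: "nat \<Rightarrow> nat \<Rightarrow> (nat \<Rightarrow> nat \<Rightarrow> int) \<Rightarrow> nat \<Rightarrow> nat \<Rightarrow> nat \<Rightarrow> int" where
  "pair_point i j en s t = (\<lambda>k\<in>{i, j}. if k = i then en i s else en j t)"

lemma pair_point_swap: "i \<noteq> j \<Longrightarrow> pair_point j i en t s = pair_point i j en s t"
  by (auto simp: pair_point_def fun_eq_iff)

text \<open>For \<open>x i < y i\<close>, raise \<open>x j\<close> to the top of strip
  \<open>I\<close> and \<open>x i\<close> to the bottom of the later block; \<open>dom\<close> then
  trades the height of the strip in \<open>j\<close> for the height of that block in
  \<open>i\<close>. The values of \<open>i\<close> are the tops of blocks, so the point reached lies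
  below \<open>y\<close>.\<close>

lemma lex_increasing_pair:
  assumes "i \<noteq> j" and f: "monotone_pattern {i, j} {i, j} A f"
    and en: "\<And>k l. k \<in> {i, j} \<Longrightarrow> l < p * n \<Longrightarrow> en k l \<in> A k"
    and mono: "\<And>k. k \<in> {i, j} \<Longrightarrow> strict_mono_on {..<p * n} (en k)"
    and "1 \<le> n" and I: "I < p" and T: "T \<subseteq> {..<p}" "card T = n"
    and dom: "\<And>w. w \<in> T \<Longrightarrow>
      f (pair_point i j en (w * n) (I * n + n - 1)) \<le> f (pair_point i j en (w * n + n - 1) (I * n))"
    and B: "B = (\<lambda>k\<in>{i, j}. if k = i then (\<lambda>w. en i (w * n + n - 1)) ` T else en j ` {I * n..<I * n + n})"
  shows "B \<in> sub_boxes {i, j} A (\<lambda>_. n)" and "lex_increasing [i, j] B f"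
proof -
  have idx: "w * n + r < p * n" if "w < p" "r < n" for w r
  proof -
    have "w * n + r < Suc w * n" using that(2) by simp
    also have "\<dots> \<le> p * n" using that(1) by (intro mult_le_mono1) simp
    finally show ?thesis .
  qed
  have hi: "w * n + n - 1 < p * n" if "w < p" for w
    using idx[OF that, of "n - 1"] \<open>1 \<le> n\<close> by simp
  have Tp: "w < p" if "w \<in> T" for w using T(1) that by auto
  have Ip: "k < p * n" if "k < I * n + n" for k
    using hi[OF I] that by simp
  have en_less: "en k l < en k l' \<longleftrightarrow> l < l'" if "k \<in> {i, j}" "l < p * n" "l' < p * n" for k l l'
    using mono[OF that(1)] that(2,3) by (simp add: strict_mono_on_less)
  have inji: "inj_on (\<lambda>w. en i (w * n + n - 1)) T"
  proof (rule inj_onI)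
    fix w w' assume w: "w \<in> T" "w' \<in> T" "en i (w * n + n - 1) = en i (w' * n + n - 1)"
    have "w * n + n - 1 = w' * n + n - 1"
      using w en_less[of i, OF _ hi[OF Tp[OF w(1)]] hi[OF Tp[OF w(2)]]]
        en_less[of i, OF _ hi[OF Tp[OF w(2)]] hi[OF Tp[OF w(1)]]] by (metis insertI1 less_irrefl linorder_neqE_nat)
    then have "w * n = w' * n" using \<open>1 \<le> n\<close> by arith
    then show "w = w'" using \<open>1 \<le> n\<close> by simp
  qed
  have injj: "inj_on (en j) {I * n..<I * n + n}"
    by (rule inj_on_subset[OF strict_mono_on_imp_inj_on[OF mono]]) (use Ip in auto)
  show sub: "B \<in> sub_boxes {i, j} A (\<lambda>_. n)"
    unfolding sub_boxes_def
  proof (rule PiE_I)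
    show "B k \<in> {S. S \<subseteq> A k \<and> card S = n}" if "k \<in> {i, j}" for k
      using that en hi Tp Ip card_image[OF inji] card_image[OF injj] T(2) \<open>i \<noteq> j\<close> by (auto simp: B)
  qed (auto simp: B)
  have BA: "Pi\<^sub>E {i, j} B \<subseteq> Pi\<^sub>E {i, j} A" using box_sub_box[OF sub] by blast
  have ptA: "pair_point i j en s t \<in> Pi\<^sub>E {i, j} A" if "s < p * n" "t < p * n" for s t
    using en that by (auto simp: pair_point_def)
  have "f x < f y" if x: "x \<in> Pi\<^sub>E {i, j} B" and y: "y \<in> Pi\<^sub>E {i, j} B" and less: "x i < y i" for x y
  proof -
    have "x i \<in> B i" "y i \<in> B i" "x j \<in> B j" "y j \<in> B j" using x y by auto
    then obtain w w' k k' where w: "w \<in> T" "x i = en i (w * n + n - 1)"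
      and w': "w' \<in> T" "y i = en i (w' * n + n - 1)"
      and k: "I * n \<le> k" "k < I * n + n" "x j = en j k"
      and k': "I * n \<le> k'" "k' < I * n + n" "y j = en j k'"
      using \<open>i \<noteq> j\<close> by (auto simp: B)
    have wp: "w < p" "w' < p" using Tp w w' by auto
    have "w * n + n - 1 < w' * n + n - 1"
      using less w w' en_less[of i, OF _ hi[OF wp(1)] hi[OF wp(2)]] by simp
    then have "w * n < w' * n" by arith
    then have "w < w'" by simp
    then have "Suc w * n \<le> w' * n" by (intro mult_le_mono1) simp
    then have ww: "w * n + n - 1 < w' * n" using \<open>1 \<le> n\<close> unfolding mult_Suc by arith
    have w'n: "w' * n < p * n" using wp(2) \<open>1 \<le> n\<close> by simp
    have In: "I * n < p * n" using I \<open>1 \<le> n\<close> by simp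
    have "f x \<le> f (pair_point i j en (w * n + n - 1) (I * n + n - 1))"
    proof (rule increasing_le[OF f _ _ ptA[OF hi[OF wp(1)] hi[OF I]]])
      have "en j k \<le> en j (I * n + n - 1)"
        using k en_less[of j "I * n + n - 1" k] hi[OF I] Ip[OF k(2)] by (simp add: not_less[symmetric])
      then show "x l \<le> pair_point i j en (w * n + n - 1) (I * n + n - 1) l" if "l \<in> {i, j}" for l
        using that w k by (auto simp: pair_point_def)
    qed (use x BA in auto)
    also have "\<dots> < f (pair_point i j en (w' * n) (I * n + n - 1))"
    proof (rule increasing_less[OF f _ ptA[OF hi[OF wp(1)] hi[OF I]] ptA[OF w'n hi[OF I]], of i])
      show *: "pair_point i j en (w * n + n - 1) (I * n + n - 1) i < pair_point i j en (w' * n) (I * n + n - 1) i"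
        using en_less[of i, OF _ hi[OF wp(1)] w'n] ww by (simp add: pair_point_def)
      show "pair_point i j en (w * n + n - 1) (I * n + n - 1) l \<le> pair_point i j en (w' * n) (I * n + n - 1) l"
        if "l \<in> {i, j}" for l
        using that * by (auto simp: pair_point_def)
    qed auto
    also have "\<dots> \<le> f (pair_point i j en (w' * n + n - 1) (I * n))" using dom[OF w'(1)] .
    also have "\<dots> \<le> f y"
    proof (rule increasing_le[OF f _ ptA[OF hi[OF wp(2)] In]])
      have "en j (I * n) \<le> en j k'"
        using k' en_less[of j k' "I * n"] In Ip[OF k'(2)] by (simp add: not_less[symmetric])
      then show "pair_point i j en (w' * n + n - 1) (I * n) l \<le> y l" if "l \<in> {i, j}" for l
        using that w' k' by (auto simp: pair_point_def)
    qed (use y BA in auto)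
    finally show ?thesis .
  qed
  moreover have "f (x(i := a)) < f (y(i := a))"
    if a: "a \<in> B i" and x: "x \<in> Pi\<^sub>E {j} B" and y: "y \<in> Pi\<^sub>E {j} B" and less: "x j < y j" for a x y
  proof (rule increasing_less[OF f, of _ _ j])
    show "x(i := a) \<in> Pi\<^sub>E {i, j} A" "y(i := a) \<in> Pi\<^sub>E {i, j} A"
      using box_updI[OF x a] box_updI[OF y a] BA by auto
  qed (use less \<open>i \<noteq> j\<close> in auto)
  ultimately show "lex_increasing [i, j] B f" by auto
qed

lemma exists_dominated_line_pair:
  fixes f :: "(nat \<Rightarrow> int) \<Rightarrow> real"
  assumes "i \<noteq> j" and "1 \<le> p"
  shows "\<exists>a\<in>{i, j}. \<exists>b\<in>{i, j}. a \<noteq> b \<and> (\<exists>I<p. \<exists>S\<subseteq>{..<p}. p \<le> 2 * card S \<and>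
    (\<forall>w\<in>S. f (pair_point a b en (w * n) (I * n + n - 1)) \<le> f (pair_point a b en (w * n + n - 1) (I * n))))"
proof -
  obtain I S where IS: "I < p" "S \<subseteq> {..<p}" "p \<le> 2 * card S"
    and dom: "(\<forall>w\<in>S. f (pair_point i j en (w * n) (I * n + n - 1)) \<le> f (pair_point i j en (w * n + n - 1) (I * n))) \<or>
     (\<forall>w\<in>S. f (pair_point i j en (I * n + n - 1) (w * n)) \<le> f (pair_point i j en (I * n) (w * n + n - 1)))"
    using exists_half_dominated_line[OF \<open>1 \<le> p\<close>, of "\<lambda>s t. f (pair_point i j en s t)" n] by blast
  from dom show ?thesis
  proof
    assume "\<forall>w\<in>S. f (pair_point i j en (w * n) (I * n + n - 1)) \<le> f (pair_point i j en (w * n + n - 1) (I * n))"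
    then show ?thesis using IS \<open>i \<noteq> j\<close> by blast
  next
    assume "\<forall>w\<in>S. f (pair_point i j en (I * n + n - 1) (w * n)) \<le> f (pair_point i j en (I * n) (w * n + n - 1))"
    then have "\<forall>w\<in>S. f (pair_point j i en (w * n) (I * n + n - 1)) \<le> f (pair_point j i en (w * n + n - 1) (I * n))"
      using pair_point_swap[OF \<open>i \<noteq> j\<close>] by simp
    then show ?thesis
      using IS \<open>i \<noteq> j\<close> by (intro bexI[of _ j] bexI[of _ i] conjI exI[of _ I] exI[of _ S]) auto
  qed
qed

text \<open>With \<open>2 * n\<close> blocks of side \<open>n\<close> per coordinate, half a line of
  blocks supplies the \<open>n\<close> values of the leading coordinate and a single block those of
  the other.\<close>

lemma forces_lex_2:
  assumes "1 \<le> n"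
  shows "forces_lex 2 n (2 * n * n)"
  unfolding forces_lex_def
proof (intro allI impI, elim conjE)
  fix D A and f :: "(nat \<Rightarrow> int) \<Rightarrow> real"
  assume "finite D" "card D = 2" and A: "\<forall>i\<in>D. finite (A i) \<and> 2 * n * n \<le> card (A i)"
    and f: "monotone_pattern D D A f"
  then obtain i j where D: "D = {i, j}" "i \<noteq> j" by (meson card_2_iff)
  obtain en where en: "\<And>k l. k \<in> D \<Longrightarrow> l < 2 * n * n \<Longrightarrow> en k l \<in> A k"
    "\<And>k. k \<in> D \<Longrightarrow> strict_mono_on {..<2 * n * n} (en k)"
    using finite_sets_enumeration[of D A "2 * n * n"] A by blast
  obtain a b I S where ab: "a \<in> {i, j}" "b \<in> {i, j}" "a \<noteq> b" and I: "I < 2 * n" and S: "S \<subseteq> {..<2 * n}"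
    "2 * n \<le> 2 * card S"
    and dom: "\<forall>w\<in>S. f (pair_point a b en (w * n) (I * n + n - 1)) \<le> f (pair_point a b en (w * n + n - 1) (I * n))"
    using exists_dominated_line_pair[OF D(2), of "2 * n" f en n] \<open>1 \<le> n\<close> by force
  have Dab: "D = {a, b}" using D ab by auto
  obtain T where T: "T \<subseteq> S" "card T = n" using S(2) by (metis mult_le_cancel1 obtain_subset_with_card_n zero_less_numeral)
  define B where "B = (\<lambda>k\<in>{a, b}. if k = a then (\<lambda>w. en a (w * n + n - 1)) ` T else en b ` {I * n..<I * n + n})"
  have "B \<in> sub_boxes {a, b} A (\<lambda>_. n) \<and> lex_increasing [a, b] B f"
    using lex_increasing_pair[OF ab(3) f[unfolded Dab] en[unfolded Dab] \<open>1 \<le> n\<close> I _ T(2) _ B_def]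
      T(1) S(1) dom by blast
  then show "\<exists>B\<in>sub_boxes D A (\<lambda>_. n). \<exists>is. distinct is \<and> set is = D \<and> lex_increasing is B f"
    using Dab ab(3) by (intro bexI[of _ B] exI[of _ "[a, b]"]) auto
qed

section \<open>Three coordinates: windows common to many slices\<close>

text \<open>Using the whole box of a slice as its key would cost \<open>(p * n choose n) ^ 2\<close>
  keys. Here only the ordered pair of coordinates and the strip \<open>I\<close> are pigeonholed,
  \<open>4 * p\<close> keys in all; the set of dominated windows still varies with the slice, and
  \<open>exists_common_subset\<close> extracts \<open>n\<close> common ones.\<close>

lemma forces_lex_3_aux:
  assumes "1 \<le> n" and p: "p = 2 * n * (n + 1)" and "n * p ^ n \<le> v * (n * n) ^ n"
  shows "forces_lex 3 n ((2 * 3 * (p * n) + 1) * (3 * (2 * 3 + 1) ^ 3 * (4 * p * v)))"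
  unfolding forces_lex_def
proof (intro allI impI, elim conjE)
  fix D A and f :: "(nat \<Rightarrow> int) \<Rightarrow> real"
  assume D: "finite D" "card D = 3" and f: "monotone_pattern D D A f"
    and A: "\<forall>i\<in>D. finite (A i) \<and> (2 * 3 * (p * n) + 1) * (3 * (2 * 3 + 1) ^ 3 * (4 * p * v)) \<le> card (A i)"
  have "D \<noteq> {}" using D by auto
  have "1 \<le> p" using p \<open>1 \<le> n\<close> by simp
  have "0 < n * p ^ n" using \<open>1 \<le> n\<close> \<open>1 \<le> p\<close> by simp
  then have "1 \<le> v" using assms(3) by (cases v) auto
  define u where "u = 4 * p * v"
  have "1 \<le> u" using \<open>1 \<le> v\<close> \<open>1 \<le> p\<close> by (simp add: u_def)
  have "\<exists>i\<in>D. \<exists>U\<subseteq>A i. \<exists>J\<in>sub_boxes (D - {i}) A (\<lambda>_. p * n). card U = u \<and>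
    (\<forall>x\<in>Pi\<^sub>E D (J(i := U)). \<forall>y\<in>Pi\<^sub>E D (J(i := U)). x i < y i \<longrightarrow> f x < f y)"
    using A D(2) \<open>1 \<le> u\<close> \<open>1 \<le> p\<close> \<open>1 \<le> n\<close>
    by (intro exists_leading_coordinate[OF D(1) \<open>D \<noteq> {}\<close> f]) (auto simp: u_def)
  then obtain i U J where i: "i \<in> D" and U: "U \<subseteq> A i" "card U = u"
    and J: "J \<in> sub_boxes (D - {i}) A (\<lambda>_. p * n)"
    and lead: "\<forall>x\<in>Pi\<^sub>E D (J(i := U)). \<forall>y\<in>Pi\<^sub>E D (J(i := U)). x i < y i \<longrightarrow> f x < f y"
    by blast
  have finJ: "finite (J j) \<and> p * n \<le> card (J j)" if "j \<in> D - {i}" for j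
    using sub_boxesD[OF J that] A that finite_subset by auto
  have "card (D - {i}) = 2" using D i by simp
  then obtain j k where jk: "D - {i} = {j, k}" "j \<noteq> k" by (meson card_2_iff)
  obtain en where en: "\<And>l m. l \<in> D - {i} \<Longrightarrow> m < p * n \<Longrightarrow> en l m \<in> J l"
    "\<And>l. l \<in> D - {i} \<Longrightarrow> strict_mono_on {..<p * n} (en l)"
    using finite_sets_enumeration[of "D - {i}" J "p * n"] finJ by blast
  have finU: "finite U" using U(1) A i finite_subset by blast
  define dom where "dom z a b I w \<longleftrightarrow> f ((pair_point a b en (w * n) (I * n + n - 1))(i := z))
      \<le> f ((pair_point a b en (w * n + n - 1) (I * n))(i := z))" for z a b I w
  define keys where "keys = {j, k} \<times> {j, k} \<times> {..<p}"
  define good where "good z \<kappa> S \<longleftrightarrow> (case \<kappa> of (a, b, I) \<Rightarrow> a \<noteq> b \<and> S \<subseteq> {..<p} \<and> p \<le> 2 * card S \<and>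
      (\<forall>w\<in>S. dom z a b I w))" for z \<kappa> S
  have "\<exists>\<kappa>\<in>keys. \<exists>Z\<subseteq>U. card Z = v \<and> (\<forall>z\<in>Z. \<exists>S. good z \<kappa> S)"
  proof (rule pigeonhole_relation)
    show "finite keys" by (simp add: keys_def)
    show "finite U" by fact
    show "U \<noteq> {}" using U(2) \<open>1 \<le> u\<close> by auto
    show "card keys * v \<le> card U" using jk(2) U(2) by (simp add: keys_def u_def card_cartesian_product)
    show "\<exists>\<kappa>\<in>keys. \<exists>S. good z \<kappa> S" for z
    proof -
      obtain a b I S where "a \<in> {j, k}" "b \<in> {j, k}" "a \<noteq> b" "I < p" "S \<subseteq> {..<p}" "p \<le> 2 * card S"
        "\<forall>w\<in>S. dom z a b I w"
        using exists_dominated_line_pair[OF jk(2) \<open>1 \<le> p\<close>, of "\<lambda>x. f (x(i := z))" en n]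
        unfolding dom_def by blast
      then show ?thesis
        unfolding keys_def by (intro bexI[of _ "(a, b, I)"] exI[of _ S]) (auto simp: good_def)
    qed
  qed
  then obtain a b I Z where ab: "a \<in> {j, k}" "b \<in> {j, k}" and I: "I < p" and Z: "Z \<subseteq> U" "card Z = v"
    and goodZ: "\<forall>z\<in>Z. \<exists>S. good z (a, b, I) S"
    unfolding keys_def by auto
  obtain S where S: "\<And>z. z \<in> Z \<Longrightarrow> good z (a, b, I) (S z)" using goodZ by metis
  have "\<exists>T\<subseteq>{..<p}. card T = n \<and> (\<exists>Z'\<subseteq>Z. card Z' = n \<and> (\<forall>z\<in>Z'. T \<subseteq> S z))"
  proof (rule exists_common_subset)
    show "finite Z" using Z(1) finU finite_subset by blast
    \<comment> \<open>Half of \<open>p = 2 * n * (n + 1)\<close> is \<open>n + n * n\<close>: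
      \<open>n\<close> windows to choose and the reserve \<open>n * n\<close>.\<close>
    show "S z \<subseteq> {..<p} \<and> n + n * n \<le> card (S z)" if "z \<in> Z" for z
    proof -
      have "2 * (n + n * n) \<le> 2 * card (S z)"
        using S[OF that] p by (simp add: good_def algebra_simps)
      then show ?thesis using S[OF that] by (simp add: good_def)
    qed
    show "n * p ^ n \<le> card Z * (n * n) ^ n" using assms(3) Z(2) by simp
  qed (use \<open>1 \<le> n\<close> \<open>1 \<le> p\<close> in auto)
  then obtain T Z' where T: "T \<subseteq> {..<p}" "card T = n" and Z': "Z' \<subseteq> Z" "card Z' = n"
    and TS: "\<forall>z\<in>Z'. T \<subseteq> S z" by blast
  obtain z where "z \<in> Z'" using Z'(2) \<open>1 \<le> n\<close> by fastforce
  then have "a \<noteq> b" using S Z'(1) by (auto simp: good_def)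
  then have Dab: "D - {i} = {a, b}" using jk ab by auto
  define B where "B = (\<lambda>k\<in>{a, b}. if k = a then (\<lambda>w. en a (w * n + n - 1)) ` T else en b ` {I * n..<I * n + n})"
  have B: "B \<in> sub_boxes {a, b} J (\<lambda>_. n) \<and> lex_increasing [a, b] B (\<lambda>x. f (x(i := z)))" if z: "z \<in> Z'" for z
  proof -
    have "monotone_pattern D (D - {i}) J (\<lambda>x. f (x(i := z)))"
      using monotone_pattern_subset[OF monotone_pattern_slice[OF f i]] z Z'(1) Z(1) U(1) sub_boxesD[OF J] by blast
    then have fz: "monotone_pattern {a, b} {a, b} J (\<lambda>x. f (x(i := z)))"
      unfolding Dab[symmetric] by (simp add: monotone_pattern_def)
    have "dom z a b I w" if "w \<in> T" for w
    proof -
      have "z \<in> Z" "w \<in> S z" using Z'(1) TS z that by blast+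
      then show ?thesis using S[of z] by (simp add: good_def)
    qed
    then show ?thesis
      using lex_increasing_pair[OF \<open>a \<noteq> b\<close> fz en[unfolded Dab] \<open>1 \<le> n\<close> I T _ B_def]
      unfolding dom_def by blast
  qed
  have "B(i := Z') \<in> sub_boxes D A (\<lambda>_. n) \<and> lex_increasing (i # [a, b]) (B(i := Z')) f"
  proof (rule lex_increasing_Cons[OF i J U(1) lead _ Z'(2)])
    show "Z' \<subseteq> U" using Z Z' by blast
    show "B \<in> sub_boxes (D - {i}) J (\<lambda>_. n)" using B[OF \<open>z \<in> Z'\<close>] Dab by simp
  qed (use B Dab in auto)
  moreover have "distinct (i # [a, b])" "set (i # [a, b]) = D" using Dab \<open>a \<noteq> b\<close> i by auto
  ultimately show "\<exists>B\<in>sub_boxes D A (\<lambda>_. n). \<exists>is. distinct is \<and> set is = D \<and> lex_increasing is B f"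
    by blast
qed

section \<open>Line-monotone arrays and the general monotone bound\<close>

text \<open>Unlike in \<open>monotone_pattern\<close>, parallel lines may run in opposite
  directions.\<close>

definition line_monotone :: "nat set \<Rightarrow> (nat \<Rightarrow> int set) \<Rightarrow> ((nat \<Rightarrow> int) \<Rightarrow> real) \<Rightarrow> bool" where
  "line_monotone D B f \<longleftrightarrow> (\<forall>i\<in>D. \<forall>x\<in>Pi\<^sub>E D B.
     (\<forall>a\<in>B i. \<forall>b\<in>B i. a < b \<longrightarrow> f (x(i := a)) < f (x(i := b))) \<or>
     (\<forall>a\<in>B i. \<forall>b\<in>B i. a < b \<longrightarrow> f (x(i := b)) < f (x(i := a))))"

definition forces_line_monotone :: "nat \<Rightarrow> nat \<Rightarrow> nat \<Rightarrow> bool" where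
  "forces_line_monotone d m Q \<longleftrightarrow>
     (\<forall>D A f. finite D \<and> card D = d \<and> (\<forall>i\<in>D. finite (A i) \<and> Q \<le> card (A i)) \<and>
        inj_on f (Pi\<^sub>E D A) \<longrightarrow> (\<exists>B\<in>sub_boxes D A (\<lambda>_. m). line_monotone D B f))"

lemma forces_line_monotone_0: "forces_line_monotone 0 m Q"
  by (auto simp: forces_line_monotone_def line_monotone_def sub_boxes_def)

text \<open>The relation coloured by \<open>S\<close> records, simultaneously for all points \<open>x\<close> of the
  base box, in which direction \<open>f\<close> moves; it is transitive, so one chain serves all lines.\<close>

lemma forces_line_monotone_Suc:
  assumes "forces_line_monotone d m Q" and "1 \<le> m" and "Q \<le> Q'" and "0 < Q'"
    and Q': "(Q choose m) ^ d * ((m - 1) ^ (2 ^ (m ^ d)) + 1) \<le> Q'"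
  shows "forces_line_monotone (Suc d) m Q'"
  unfolding forces_line_monotone_def
proof (intro allI impI, elim conjE)
  fix D A and f :: "(nat \<Rightarrow> int) \<Rightarrow> real"
  assume D: "finite D" "card D = Suc d" and A: "\<forall>i\<in>D. finite (A i) \<and> Q' \<le> card (A i)"
    and inj: "inj_on f (Pi\<^sub>E D A)"
  obtain j where j: "j \<in> D" using D by fastforce
  define E where "E = D - {j}"
  have E: "finite E" "card E = d" "j \<notin> E" "D = insert j E" using D j by (auto simp: E_def)
  \<comment> \<open>The exponent \<open>2 ^ (m ^ d)\<close> is the number of sign patterns on the
    \<open>m ^ d\<close> points of the base box.\<close>
  define N where "N = (m - 1) ^ (2 ^ (m ^ d)) + 1"
  have QA: "Q \<le> card (A i)" if "i \<in> E" for i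
    using A E(4) that \<open>Q \<le> Q'\<close> by (meson insertI2 le_trans)
  obtain A' where A': "A' \<in> sub_boxes E A (\<lambda>_. Q)"
    using exists_sub_box[of E "\<lambda>_. Q" A] QA by blast
  have finA': "finite (A' i)" "card (A' i) = Q" if "i \<in> E" for i
    using sub_boxesD[OF A' that] A E(4) that finite_subset by auto
  define K where "K = sub_boxes E A' (\<lambda>_. m)"
  have finK: "finite K" unfolding K_def using finite_sub_boxes[of E A'] finA' E(1) by auto
  have cardK: "card K = (Q choose m) ^ d"
    unfolding K_def using finA' E by (simp add: card_sub_boxes)
  have "\<exists>B\<in>K. \<exists>Z\<subseteq>A j. card Z = N \<and> (\<forall>z\<in>Z. line_monotone E B (\<lambda>x. f (x(j := z))))"
  proof (rule pigeonhole_relation[OF finK])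
    show "finite (A j)" using A j by simp
    show "A j \<noteq> {}" using A j \<open>0 < Q'\<close> by auto
    have "card K * N \<le> Q'" using Q' cardK N_def by simp
    then show "card K * N \<le> card (A j)" using A j le_trans by blast
    show "\<exists>B\<in>K. line_monotone E B (\<lambda>x. f (x(j := z)))" if "z \<in> A j" for z
    proof -
      have "inj_on (\<lambda>x. f (x(j := z))) (Pi\<^sub>E E A')"
        using inj_on_slice[OF inj[unfolded E(4)] that E(3)] box_sub_box[OF A'] by (meson inj_on_subset subsetI)
      then show ?thesis
        using assms(1)[unfolded forces_line_monotone_def, rule_format, of E A' "\<lambda>x. f (x(j := z))"] finA' E
        unfolding K_def by auto
    qed
  qed
  then obtain B Z where B: "B \<in> sub_boxes E A' (\<lambda>_. m)" and Z: "Z \<subseteq> A j" "card Z = N"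
    and lines: "\<forall>z\<in>Z. line_monotone E B (\<lambda>x. f (x(j := z)))"
    unfolding K_def by blast
  have BA: "B \<in> sub_boxes E A (\<lambda>_. m)" using sub_boxes_trans[OF A' B] .
  have finB: "finite (B i)" "card (B i) = m" if "i \<in> E" for i
    using sub_boxesD[OF BA that] A E(4) that finite_subset by auto
  define P where "P = Pi\<^sub>E E B"
  have P: "finite P" "card P = m ^ d"
    unfolding P_def using finB E by (auto simp: card_PiE intro: finite_PiE)
  define R where "R S y z \<longleftrightarrow> (\<forall>x\<in>P. if x \<in> S then f (x(j := y)) < f (x(j := z))
      else f (x(j := z)) < f (x(j := y)))" for S y z
  have "\<exists>S\<in>Pow P. \<exists>Z'\<subseteq>Z. card Z' = m \<and> (\<forall>x\<in>Z'. \<forall>y\<in>Z'. x < y \<longrightarrow> R S x y)"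
  proof (rule transitive_colours_chain)
    show "finite (Pow P)" using P(1) by simp
    show "finite Z" using Z A j finite_subset by blast
    show "(m - 1) ^ card (Pow P) < card Z" using Z(2) P by (simp add: card_Pow N_def)
    show "R S x z" if "R S x y" "R S y z" for S x y z
      using that unfolding R_def by (fastforce split: if_splits)
    show "\<exists>S\<in>Pow P. R S y z" if yz: "y \<in> Z" "z \<in> Z" "y < z" for y z
    proof -
      have "f (x(j := y)) \<noteq> f (x(j := z))" if "x \<in> P" for x
      proof -
        have xA: "x \<in> Pi\<^sub>E E A" using box_sub_box[OF BA] that P_def by blast
        have "x(j := y) \<in> Pi\<^sub>E D A" "x(j := z) \<in> Pi\<^sub>E D A"
          using box_updI[OF xA, of _ j] yz(1,2) Z(1) E(4) by blast+
        moreover have "x(j := y) \<noteq> x(j := z)" using yz(3) by (metis fun_upd_same less_irrefl)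
        ultimately show ?thesis using inj by (meson inj_onD)
      qed
      then have "R {x\<in>P. f (x(j := y)) < f (x(j := z))} y z"
        unfolding R_def by (auto simp: not_less less_le)
      then show ?thesis by blast
    qed
  qed (use \<open>1 \<le> m\<close> in auto)
  then obtain S Z' where Z': "Z' \<subseteq> Z" "card Z' = m" and R: "\<forall>x\<in>Z'. \<forall>y\<in>Z'. x < y \<longrightarrow> R S x y"
    by blast
  have sub: "B(j := Z') \<in> sub_boxes D A (\<lambda>_. m)"
    using sub_boxes_insert[OF BA, of Z' j] Z' Z(1) E(4) by auto
  have "line_monotone D (B(j := Z')) f"
    unfolding line_monotone_def
  proof (intro ballI)
    fix i x assume i: "i \<in> D" and x: "x \<in> Pi\<^sub>E D (B(j := Z'))"
    obtain y a where y: "y \<in> P" "a \<in> Z'" "x = y(j := a)"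
      using x unfolding E(4) P_def by (elim box_insertE) (auto simp: box_upd_notin[OF E(3)])
    show "(\<forall>a\<in>(B(j := Z')) i. \<forall>b\<in>(B(j := Z')) i. a < b \<longrightarrow> f (x(i := a)) < f (x(i := b))) \<or>
       (\<forall>a\<in>(B(j := Z')) i. \<forall>b\<in>(B(j := Z')) i. a < b \<longrightarrow> f (x(i := b)) < f (x(i := a)))"
    proof (cases "i = j")
      case True
      then show ?thesis using R y by (cases "y \<in> S") (auto simp: R_def)
    next
      case False
      then have "i \<in> E" using i E(4) by simp
      moreover have "a \<in> Z" using y(2) Z'(1) by blast
      ultimately have "(\<forall>b\<in>B i. \<forall>c\<in>B i. b < c \<longrightarrow> f (y(i := b, j := a)) < f (y(i := c, j := a))) \<or>
          (\<forall>b\<in>B i. \<forall>c\<in>B i. b < c \<longrightarrow> f (y(i := c, j := a)) < f (y(i := b, j := a)))"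
        using lines y(1) unfolding line_monotone_def P_def by blast
      moreover have "y(i := b, j := a) = x(i := b)" for b
        using y(3) False fun_upd_twist[of i j y b a] by simp
      ultimately show ?thesis using False by simp
    qed
  qed
  then show "\<exists>B\<in>sub_boxes D A (\<lambda>_. m). line_monotone D B f" using sub by blast
qed

text \<open>Colour a point by the set of coordinates whose line through it is increasing. On a box
  where this set is constant, all parallel lines agree in direction.\<close>

lemma forces_monotone_of_lines:
  assumes "forces_line_monotone (card D) m Q" and "finite D"
    and ramsey: "box_ramsey D (\<lambda>_. m) (\<lambda>_. k) (2 ^ card D)"
  shows "forces_monotone D (\<lambda>_. Q) (\<lambda>_. k)"
  unfolding forces_monotone_def
proof (intro allI impI, elim conjE)
  fix A and f :: "(nat \<Rightarrow> int) \<Rightarrow> real"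
  assume A: "\<forall>i\<in>D. finite (A i) \<and> Q \<le> card (A i)" and inj: "inj_on f (Pi\<^sub>E D A)"
  obtain B where B: "B \<in> sub_boxes D A (\<lambda>_. m)" and lines: "line_monotone D B f"
    using assms(1)[unfolded forces_line_monotone_def, rule_format, of D A f] A inj \<open>finite D\<close> by auto
  \<comment> \<open>Numbers the subsets of \<open>D\<close>, since \<open>box_ramsey\<close> takes
    natural numbers below \<open>r\<close> as colours.\<close>
  obtain h :: "nat set \<Rightarrow> nat" where h: "bij_betw h (Pow D) {0..<2 ^ card D}"
    using ex_bij_betw_finite_nat[of "Pow D"] \<open>finite D\<close> card_Pow[OF \<open>finite D\<close>] by auto
  define inc where "inc x = {i\<in>D. \<forall>a\<in>B i. \<forall>b\<in>B i. a < b \<longrightarrow> f (x(i := a)) < f (x(i := b))}" for x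
  have hinc: "h (inc x) < 2 ^ card D" for x
    using bij_betwE[OF h] by (auto simp: inc_def)
  have "finite (B i)" "card (B i) = m" if "i \<in> D" for i
    using sub_boxesD[OF B that] A that finite_subset by auto
  then have "\<exists>C\<in>sub_boxes D B (\<lambda>_. k). \<exists>\<kappa><2 ^ card D. \<forall>x\<in>Pi\<^sub>E D C. h (inc x) = \<kappa>"
    using ramsey[unfolded box_ramsey_def, rule_format, of B "\<lambda>x. h (inc x)"] hinc by simp
  then obtain C \<kappa> where C: "C \<in> sub_boxes D B (\<lambda>_. k)" and \<kappa>: "\<kappa> < 2 ^ card D"
    "\<forall>x\<in>Pi\<^sub>E D C. h (inc x) = \<kappa>" by blast
  obtain S where S: "S \<subseteq> D" "h S = \<kappa>"
    using h \<kappa>(1) unfolding bij_betw_def by (metis PowD atLeastLessThan_iff imageE zero_le)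
  have inc: "inc x = S" if "x \<in> Pi\<^sub>E D C" for x
  proof -
    have "h (inc x) = h S" using \<kappa>(2) S(2) that by simp
    then show ?thesis using h S(1) by (auto simp: bij_betw_def inc_def dest!: inj_onD)
  qed
  have "monotone_pattern S D C f"
    unfolding monotone_pattern_def
  proof (intro ballI impI)
    fix i x b assume i: "i \<in> D" and x: "x \<in> Pi\<^sub>E D C" and b: "b \<in> C i" "x i < b"
    have xB: "x \<in> Pi\<^sub>E D B" using box_sub_box[OF C x] .
    have "x i \<in> B i" "b \<in> B i" using xB i b sub_boxesD[OF C i] by auto
    have "f (x(i := x i)) < f (x(i := b))" if "i \<in> S"
      using that \<open>x i \<in> B i\<close> \<open>b \<in> B i\<close> b(2) unfolding inc[OF x, symmetric] inc_def by blast
    moreover have "f (x(i := b)) < f (x(i := x i))" if "i \<notin> S"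
      using that i \<open>x i \<in> B i\<close> \<open>b \<in> B i\<close> b(2) lines xB unfolding inc[OF x, symmetric] inc_def line_monotone_def by blast
    ultimately show "if i \<in> S then f x < f (x(i := b)) else f (x(i := b)) < f x" by simp
  qed
  then show "\<exists>B\<in>sub_boxes D A (\<lambda>_. k). \<exists>S\<subseteq>D. monotone_pattern S D B f"
    using sub_boxes_trans[OF B C] S(1) by blast
qed

section \<open>Monotonicity in the sizes, and numerical bounds\<close>

lemma box_ramsey_mono:
  assumes "box_ramsey D q p r" and "\<And>i. i \<in> D \<Longrightarrow> q i \<le> q' i"
  shows "box_ramsey D q' p r"
  unfolding box_ramsey_def
proof (intro allI impI, elim conjE)
  fix A and c :: "(nat \<Rightarrow> int) \<Rightarrow> nat"
  assume A: "\<forall>i\<in>D. finite (A i) \<and> q' i \<le> card (A i)" and c: "\<forall>x\<in>Pi\<^sub>E D A. c x < r"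
  have "\<forall>i\<in>D. finite (A i) \<and> q i \<le> card (A i)" using A assms(2) le_trans by blast
  then show "\<exists>B\<in>sub_boxes D A p. \<exists>\<kappa><r. \<forall>x\<in>Pi\<^sub>E D B. c x = \<kappa>"
    using assms(1) c unfolding box_ramsey_def by blast
qed

lemma forces_monotone_mono:
  assumes "forces_monotone D Q q" and "\<And>i. i \<in> D \<Longrightarrow> Q i \<le> Q' i"
  shows "forces_monotone D Q' q"
  unfolding forces_monotone_def
proof (intro allI impI, elim conjE)
  fix A and f :: "(nat \<Rightarrow> int) \<Rightarrow> real"
  assume A: "\<forall>i\<in>D. finite (A i) \<and> Q' i \<le> card (A i)" and f: "inj_on f (Pi\<^sub>E D A)"
  have "\<forall>i\<in>D. finite (A i) \<and> Q i \<le> card (A i)" using A assms(2) le_trans by blast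
  then show "\<exists>B\<in>sub_boxes D A q. \<exists>S\<subseteq>D. monotone_pattern S D B f"
    using assms(1) f unfolding forces_monotone_def by blast
qed

lemma forces_line_monotone_mono:
  assumes "forces_line_monotone d m Q" and "Q \<le> Q'"
  shows "forces_line_monotone d m Q'"
  unfolding forces_line_monotone_def
proof (intro allI impI, elim conjE)
  fix D A and f :: "(nat \<Rightarrow> int) \<Rightarrow> real"
  assume D: "finite D" "card D = d" and A: "\<forall>i\<in>D. finite (A i) \<and> Q' \<le> card (A i)"
    and f: "inj_on f (Pi\<^sub>E D A)"
  have "\<forall>i\<in>D. finite (A i) \<and> Q \<le> card (A i)" using A assms(2) le_trans by blast
  then show "\<exists>B\<in>sub_boxes D A (\<lambda>_. m). line_monotone D B f"
    using assms(1) D f unfolding forces_line_monotone_def by blast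
qed

lemma choose_le_power: "(n choose r) \<le> n ^ r"
  by (cases "r \<le> n") (auto simp: binomial_le_pow binomial_eq_0)

text \<open>One constant as coefficient and as exponent absorbs every polynomial in
  \<open>k\<close>, so the induction tracks no degrees. Only the side of the new coordinate has to
  grow to \<open>m'\<close>; the others are raised afterwards for uniformity.\<close>

lemma box_ramsey_bound:
  "\<exists>c. \<forall>k\<ge>1. \<forall>D. finite D \<and> card D = d \<longrightarrow> box_ramsey D (\<lambda>_. 2 ^ (c * k ^ c)) (\<lambda>_. k) r"
proof (induction d)
  case 0
  then show ?case using box_ramsey_empty by auto
next
  case (Suc d)
  then obtain c where c: "\<And>k D. 1 \<le> k \<Longrightarrow> finite D \<Longrightarrow> card D = d \<Longrightarrow> box_ramsey D (\<lambda>_. 2 ^ (c * k ^ c)) (\<lambda>_. k) r"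
    by blast
  define c' where "c' = c * d + r + c + 1"
  show ?case
  proof (intro exI[of _ c'] allI impI, elim conjE)
    fix k D assume k: "1 \<le> (k::nat)" and D: "finite (D::nat set)" "card D = Suc d"
    obtain j where j: "j \<in> D" using D by fastforce
    define E where "E = D - {j}"
    have E: "finite E" "card E = d" "j \<notin> E" "D = insert j E" using D j by (auto simp: E_def)
    define m m' :: nat where "m = 2 ^ (c * k ^ c)" and "m' = 2 ^ (c' * k ^ c')"
    have le: "c * k ^ c \<le> c' * k ^ c'"
      using k by (intro mult_le_mono power_increasing) (auto simp: c'_def)
    have "c * k ^ (c + 1) * d + r + k \<le> c * d * k ^ (c + 1) + r * k ^ (c + 1) + k ^ (c + 1)"
      using k by (intro add_mono) (auto simp: self_le_power)
    also have "\<dots> = (c * d + r + 1) * k ^ (c + 1)" by (simp add: algebra_simps)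
    also have "\<dots> \<le> c' * k ^ c'"
      using k by (intro mult_le_mono power_increasing) (auto simp: c'_def)
    finally have exp: "c * k ^ (c + 1) * d + r + k \<le> c' * k ^ c'" .
    have "(m choose k) ^ d * r * k \<le> (m ^ k) ^ d * 2 ^ r * 2 ^ k"
      by (intro mult_le_mono power_mono choose_le_power) (auto simp: less_exp less_imp_le)
    also have "\<dots> = 2 ^ (c * k ^ (c + 1) * d + r + k)"
      by (simp add: m_def power_mult[symmetric] power_add[symmetric] mult_ac)
    also have "\<dots> \<le> m'" unfolding m'_def using exp by (intro power_increasing) auto
    finally have size: "(m choose k) ^ d * r * k \<le> m'" .
    define q where "q i = (if i = j then m' else m)" for i
    have "box_ramsey E q (\<lambda>_. k) r"
      by (rule box_ramsey_mono[OF c[OF k E(1,2)]]) (use E(3) in \<open>auto simp: q_def m_def\<close>)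
    moreover have "(\<Prod>i\<in>E. q i choose k) = (\<Prod>i\<in>E. m choose k)"
      by (rule prod.cong) (use E(3) in \<open>auto simp: q_def\<close>)
    then have "(\<Prod>i\<in>E. q i choose k) = (m choose k) ^ d" using E(2) by simp
    ultimately have "box_ramsey (insert j E) q (\<lambda>_. k) r"
      using size E(1,3) by (intro box_ramsey_insert) (auto simp: q_def m'_def)
    then show "box_ramsey D (\<lambda>_. 2 ^ (c' * k ^ c')) (\<lambda>_. k) r"
      unfolding E(4) by (rule box_ramsey_mono) (use le in \<open>auto simp: q_def m'_def m_def intro!: power_increasing\<close>)
  qed
qed

lemma power_minus_le:
  assumes "1 \<le> (k::nat)" and "k \<le> 2 ^ a" and "X \<le> Y"
  shows "(k - 1) ^ X + 1 \<le> 2 ^ (a * Y + 1)"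
proof -
  have "(k - 1) ^ X \<le> k ^ X" by (intro power_mono) auto
  also have "\<dots> \<le> k ^ Y" using assms by (intro power_increasing) auto
  also have "\<dots> \<le> (2 ^ a) ^ Y" using assms by (intro power_mono) auto
  finally have "(k - 1) ^ X \<le> 2 ^ (a * Y)" by (simp add: power_mult)
  moreover have "(1::nat) \<le> 2 ^ (a * Y)" by simp
  ultimately have "(k - 1) ^ X + 1 \<le> 2 ^ (a * Y) + 2 ^ (a * Y)" by (rule add_mono)
  then show ?thesis by simp
qed

text \<open>The height does not grow with the dimension: choosing a subbox raises \<open>Q\<close>
  only to the power \<open>m * d\<close>, and the chain contributes the exponent
  \<open>m * 2 ^ (m ^ d)\<close>, singly exponential in a power of \<open>m\<close>.\<close>

lemma forces_line_monotone_bound: "\<exists>c. \<forall>m\<ge>1. forces_line_monotone d m (2 ^ (2 ^ (c * m ^ c)))"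
proof (induction d)
  case 0
  then show ?case using forces_line_monotone_0 by auto
next
  case (Suc d)
  then obtain c where c: "\<And>m. 1 \<le> m \<Longrightarrow> forces_line_monotone d m (2 ^ (2 ^ (c * m ^ c)))" by blast
  define c' where "c' = c + d + 4"
  show ?case
  proof (intro exI[of _ c'] allI impI)
    fix m assume m: "1 \<le> (m::nat)"
    define E where "E = c' * m ^ c'"
    define Q :: nat where "Q = 2 ^ (2 ^ (c * m ^ c))"
    have pow: "m ^ e \<le> m ^ c'" if "e \<le> c'" for e using that m by (intro power_increasing) auto
    have one: "1 \<le> m ^ c'" using m by simp
    have "c * m ^ c + m + d + 1 \<le> c * m ^ c' + m ^ c' + d * m ^ c' + m ^ c'"
      using pow[of c] pow[of 1] one by (intro add_mono) (auto simp: c'_def)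
    also have "\<dots> = (c + d + 2) * m ^ c'" by (simp add: algebra_simps)
    also have "\<dots> \<le> E" unfolding E_def c'_def by (intro mult_le_mono1) simp
    finally have e1: "c * m ^ c + m + d + 1 \<le> E" .
    have "m ^ d + m + 2 \<le> m ^ c' + m ^ c' + 2 * m ^ c'"
      using pow[of d] pow[of 1] one by (intro add_mono) (auto simp: c'_def)
    also have "\<dots> \<le> E" unfolding E_def c'_def by (simp add: algebra_simps)
    finally have e2: "m ^ d + m + 2 \<le> E" .
    have "2 ^ (c * m ^ c) * m * d \<le> 2 ^ (c * m ^ c) * 2 ^ m * (2::nat) ^ d"
      by (intro mult_le_mono) (auto simp: less_exp less_imp_le)
    also have "\<dots> = 2 ^ (c * m ^ c + m + d)" by (simp add: power_add)
    finally have s1: "2 * (2 ^ (c * m ^ c) * m * d) \<le> (2::nat) ^ E"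
      using e1 power_increasing[OF e1, of "2::nat"] by simp
    have "m * 2 ^ (m ^ d) + 1 \<le> 2 ^ m * 2 ^ (m ^ d) + (2::nat) ^ m * 2 ^ (m ^ d)"
      by (intro add_mono mult_le_mono) (auto simp: less_exp less_imp_le)
    also have "\<dots> = 2 ^ (m ^ d + m + 1)" by (simp add: power_add)
    finally have s2: "2 * (m * 2 ^ (m ^ d) + 1) \<le> (2::nat) ^ E"
      using power_increasing[OF e2, of "2::nat"] by simp
    have "(Q choose m) ^ d * ((m - 1) ^ (2 ^ (m ^ d)) + 1) \<le> (Q ^ m) ^ d * 2 ^ (m * 2 ^ (m ^ d) + 1)"
      using power_minus_le[OF m less_imp_le[OF less_exp] order_refl] by (intro mult_le_mono power_mono choose_le_power) auto
    also have "\<dots> = 2 ^ (2 ^ (c * m ^ c) * m * d + (m * 2 ^ (m ^ d) + 1))"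
      by (simp add: Q_def power_mult[symmetric] power_add mult_ac)
    also have "\<dots> \<le> 2 ^ (2 ^ E)" using s1 s2 by (intro power_increasing) auto
    finally have size: "(Q choose m) ^ d * ((m - 1) ^ (2 ^ (m ^ d)) + 1) \<le> 2 ^ (2 ^ E)" .
    have "c * m ^ c \<le> E" using e1 by simp
    then have "Q \<le> 2 ^ (2 ^ E)" unfolding Q_def by (intro power_increasing) auto
    then have "forces_line_monotone (Suc d) m (2 ^ (2 ^ E))"
      using c[OF m] m size by (intro forces_line_monotone_Suc[of d m Q]) (auto simp: Q_def)
    then show "forces_line_monotone (Suc d) m (2 ^ (2 ^ (c' * m ^ c')))" by (simp add: E_def)
  qed
qed

text \<open>The third exponential comes from inserting the Ramsey side
  \<open>m = 2 ^ (a * k ^ a)\<close> into the doubly exponential bound for lines.\<close>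

lemma forces_monotone_bound:
  assumes "finite D"
  shows "\<exists>c. \<forall>k\<ge>1. forces_monotone D (\<lambda>_. 2 ^ (2 ^ (2 ^ (c * k ^ c)))) (\<lambda>_. k)"
proof -
  obtain a where a: "\<And>k. 1 \<le> k \<Longrightarrow> box_ramsey D (\<lambda>_. 2 ^ (a * k ^ a)) (\<lambda>_. k) (2 ^ card D)"
    using box_ramsey_bound[of "card D" "2 ^ card D"] assms by blast
  obtain b where b: "\<And>m. 1 \<le> m \<Longrightarrow> forces_line_monotone (card D) m (2 ^ (2 ^ (b * m ^ b)))"
    using forces_line_monotone_bound[of "card D"] by blast
  define c where "c = a * b + a + b"
  show ?thesis
  proof (intro exI[of _ c] allI impI)
    fix k assume k: "1 \<le> (k::nat)"
    define m :: nat where "m = 2 ^ (a * k ^ a)"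
    have "b * m ^ b \<le> 2 ^ b * 2 ^ (a * b * k ^ a)"
      by (intro mult_le_mono) (auto simp: m_def power_mult[symmetric] mult_ac less_exp less_imp_le)
    also have "\<dots> = 2 ^ (b + a * b * k ^ a)" by (simp add: power_add)
    also have "\<dots> \<le> 2 ^ (c * k ^ c)"
    proof (rule power_increasing)
      have "b + a * b * k ^ a \<le> b * k ^ c + a * b * k ^ c"
        using k by (intro add_mono mult_le_mono power_increasing) (auto simp: c_def)
      also have "\<dots> \<le> c * k ^ c" by (simp add: c_def algebra_simps)
      finally show "b + a * b * k ^ a \<le> c * k ^ c" .
    qed simp
    finally have "(2::nat) ^ (2 ^ (b * m ^ b)) \<le> 2 ^ (2 ^ (2 ^ (c * k ^ c)))"
      by (intro power_increasing) auto
    moreover have "forces_line_monotone (card D) m (2 ^ (2 ^ (b * m ^ b)))"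
      by (rule b) (simp add: m_def)
    ultimately have "forces_line_monotone (card D) m (2 ^ (2 ^ (2 ^ (c * k ^ c))))"
      using forces_line_monotone_mono by blast
    then show "forces_monotone D (\<lambda>_. 2 ^ (2 ^ (2 ^ (c * k ^ c)))) (\<lambda>_. k)"
      using forces_monotone_of_lines[OF _ assms] a[OF k] unfolding m_def by blast
  qed
qed

section \<open>From lexicographic order to lex-monotone arrays\<close>

text \<open>Unfolds the recursion down to the position where the points differ: every earlier head
  has a common value, which is fixed inside the function.\<close>

lemma lex_increasing_nth:
  assumes "lex_increasing is A f" and "distinct is"
    and "x \<in> Pi\<^sub>E (set is) A" and "y \<in> Pi\<^sub>E (set is) A" and "k < length is"
    and "\<forall>l<k. x (is ! l) = y (is ! l)" and "x (is ! k) < y (is ! k)"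
  shows "f x < f y"
  using assms
proof (induction "is" arbitrary: f x y k)
  case (Cons i "is")
  show ?case
  proof (cases k)
    case 0
    then show ?thesis using Cons.prems by simp
  next
    case (Suc m)
    have split: "z = (restrict z (set is))(i := z i)" if "z \<in> Pi\<^sub>E (set (i # is)) A" for z
    proof
      show "z t = ((restrict z (set is))(i := z i)) t" for t
        using PiE_arb[OF that, of t] by auto
    qed
    have "x i = y i" using Cons.prems(6) Suc by force
    have "f ((restrict x (set is))(i := x i)) < f ((restrict y (set is))(i := x i))"
    proof (rule Cons.IH[of "\<lambda>z. f (z(i := x i))" "restrict x (set is)" "restrict y (set is)" m])
      show "lex_increasing is A (\<lambda>z. f (z(i := x i)))" using Cons.prems(1,3) by auto
      show "restrict x (set is) \<in> Pi\<^sub>E (set is) A" "restrict y (set is) \<in> Pi\<^sub>E (set is) A"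
        using Cons.prems(3,4) by auto
      show "m < length is" using Cons.prems(5) Suc by simp
      then show "restrict x (set is) (is ! m) < restrict y (set is) (is ! m)"
        using Cons.prems(7) Suc by simp
      show "\<forall>l<m. restrict x (set is) (is ! l) = restrict y (set is) (is ! l)"
        using Cons.prems(6) Suc \<open>m < length is\<close> by auto
    qed (use Cons.prems(2) in simp)
    then show ?thesis using split[OF Cons.prems(3)] split[OF Cons.prems(4)] \<open>x i = y i\<close> by simp
  qed
qed simp

lemma lex_lessE:
  assumes "lex_less d u v"
  obtains i where "i \<in> {1..d}" "u i < v i" "\<And>l. l \<in> {1..d} \<Longrightarrow> l < i \<Longrightarrow> u l = v l"
proof -
  define i where "i = (LEAST i. i \<in> {1..d} \<and> u i \<noteq> v i)"
  have "\<exists>i. i \<in> {1..d} \<and> u i \<noteq> v i" using assms by (auto simp: lex_less_def)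
  then have "i \<in> {1..d} \<and> u i \<noteq> v i" unfolding i_def by (rule LeastI_ex)
  moreover have "u i < v i" using assms by (simp add: lex_less_def i_def Let_def)
  moreover have "u l = v l" if "l \<in> {1..d}" "l < i" for l
    using not_less_Least[of l "\<lambda>i. i \<in> {1..d} \<and> u i \<noteq> v i"] that unfolding i_def by blast
  ultimately show ?thesis using that by blast
qed

lemma lex_less_linear:
  "(\<forall>i\<in>{1..d}. u i = v i) \<or> lex_less d u v \<or> lex_less d v u"
proof (rule disjCI)
  assume neg: "\<not> (lex_less d u v \<or> lex_less d v u)"
  show "\<forall>i\<in>{1..d}. u i = v i"
  proof (rule ccontr)
    assume ne: "\<not> (\<forall>i\<in>{1..d}. u i = v i)"
    define i where "i = (LEAST i. i \<in> {1..d} \<and> u i \<noteq> v i)"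
    have i': "i = (LEAST i. i \<in> {1..d} \<and> v i \<noteq> u i)" unfolding i_def by (rule arg_cong[where f = Least]) auto
    have "i \<in> {1..d} \<and> u i \<noteq> v i" unfolding i_def by (rule LeastI_ex) (use ne in auto)
    then have "u i < v i \<or> v i < u i" by auto
    moreover have "\<exists>i\<in>{1..d}. u i \<noteq> v i" "\<exists>i\<in>{1..d}. v i \<noteq> u i" using ne by metis+
    ultimately have "lex_less d u v \<or> lex_less d v u"
      unfolding lex_less_def Let_def i_def[symmetric] i'[symmetric] by blast
    then show False using neg by simp
  qed
qed

text \<open>One implication is enough: lexicographic order is linear and separates the points of the
  box, so the converse follows by exchanging them.\<close>

lemma lex_monotoneI:
  assumes "is": "distinct is" "set is = {1..d}" and s: "\<And>i. i \<in> {1..d} \<Longrightarrow> s i \<in> {-1, 1 :: int}"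
    and less: "\<And>x y k. x \<in> box d C \<Longrightarrow> y \<in> box d C \<Longrightarrow> k < d \<Longrightarrow>
      (\<And>l. l < k \<Longrightarrow> s (is ! l) * x (is ! l) = s (is ! l) * y (is ! l)) \<Longrightarrow>
      s (is ! k) * x (is ! k) < s (is ! k) * y (is ! k) \<Longrightarrow> f x < f y"
  shows "lex_monotone d C f"
proof -
  have len: "length is = d" using "is" by (metis card_atLeastAtMost diff_Suc_1 distinct_card)
  \<comment> \<open>List positions start at 0 and coordinates at 1; outside \<open>{1..d}\<close> a
    permutation of \<open>{1..d}\<close> must be the identity.\<close>
  define \<sigma> where "\<sigma> k = (if k \<in> {1..d} then is ! (k - 1) else k)" for k
  have "bij_betw (\<lambda>k. k - 1) {1..d} {..<d}"
    by (rule bij_betw_byWitness[where f' = Suc]) auto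
  moreover have "bij_betw ((!) is) {..<d} {1..d}"
    using bij_betw_nth[OF "is"(1), of "{..<d}" "{1..d}"] len "is"(2) by simp
  ultimately have "bij_betw ((!) is \<circ> (\<lambda>k. k - 1)) {1..d} {1..d}" by (rule bij_betw_trans)
  then have "bij_betw \<sigma> {1..d} {1..d}"
    by (rule bij_betw_cong[THEN iffD1, rotated]) (auto simp: \<sigma>_def)
  then have \<sigma>: "\<sigma> permutes {1..d}" by (rule bij_imp_permutes) (auto simp: \<sigma>_def)
  define u where "u x = (\<lambda>i. real_of_int (s (\<sigma> i) * x (\<sigma> i)))" for x
  have 1: "f x < f y" if xy: "x \<in> box d C" "y \<in> box d C" and lex: "lex_less d (u x) (u y)" for x y
  proof -
    obtain i where i: "i \<in> {1..d}" "u x i < u y i" "\<And>l. l \<in> {1..d} \<Longrightarrow> l < i \<Longrightarrow> u x l = u y l"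
      using lex_lessE[OF lex] by blast
    show ?thesis
    proof (rule less[OF xy, of "i - 1"])
      show "i - 1 < d" using i(1) by auto
      show "s (is ! (i - 1)) * x (is ! (i - 1)) < s (is ! (i - 1)) * y (is ! (i - 1))"
        using i(1,2) unfolding u_def \<sigma>_def of_int_less_iff by simp
      show "s (is ! l) * x (is ! l) = s (is ! l) * y (is ! l)" if "l < i - 1" for l
      proof -
        have "Suc l \<in> {1..d}" "Suc l < i" using that i(1) by auto
        then show ?thesis using i(3)[of "Suc l"] unfolding u_def \<sigma>_def of_int_eq_iff by simp
      qed
    qed
  qed
  have 2: "x = y" if xy: "x \<in> box d C" "y \<in> box d C" and eq: "\<forall>i\<in>{1..d}. u x i = u y i" for x y
  proof (rule PiE_ext[OF xy])
    fix j assume j: "j \<in> {1..d}"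
    then obtain i where i: "i \<in> {1..d}" "\<sigma> i = j" using \<open>bij_betw \<sigma> {1..d} {1..d}\<close>
      by (metis bij_betw_imp_surj_on imageE)
    have "s j * x j = s j * y j" using eq i unfolding u_def of_int_eq_iff by blast
    then show "x j = y j" using s[OF j] by auto
  qed
  have "f x < f y \<longleftrightarrow> lex_less d (u x) (u y)" if xy: "x \<in> box d C" "y \<in> box d C" for x y
    using lex_less_linear[of d "u x" "u y"] 1[OF xy] 1[OF xy(2,1)] 2[OF xy] by force
  then show ?thesis
    unfolding lex_monotone_def u_def using \<sigma> s by (intro exI[of _ \<sigma>] exI[of _ s]) auto
qed

text \<open>Reflecting the coordinates outside \<open>S\<close> makes the array increasing; the sign
  vector in \<open>lex_monotone\<close> undoes the reflection.\<close>

lemma forces_lex_monotoneI: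
  assumes mono: "forces_monotone {1..d} (\<lambda>_. N) (\<lambda>_. K)" and lex: "forces_lex d n K" and "1 \<le> n"
  shows "forces_lex_monotone d n N"
  unfolding forces_lex_monotone_def
proof (intro allI impI, elim conjE)
  fix A f assume f: "is_array d A f" and N: "cubic_size d A N"
  define D where "D = {1..d}"
  have D: "finite D" "card D = d" by (auto simp: D_def)
  obtain B S where B: "B \<in> sub_boxes D A (\<lambda>_. K)" and S: "monotone_pattern S D B f"
    using mono[unfolded forces_monotone_def, rule_format, of A f] f N
    unfolding D_def is_array_def cubic_size_def by auto
  define s where "s i = (if i \<in> S then 1 else - 1 :: int)" for i
  have ss: "s i * (s i * t) = t" for i t by (simp add: s_def)
  define flip where "flip x = (\<lambda>i\<in>D. s i * x i)" for x
  define refl where "refl X i = (\<lambda>t. s i * t) ` X i" for X :: "nat \<Rightarrow> int set" and i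
  have flip_flip: "flip (flip x) = x" if "x \<in> Pi\<^sub>E D X" for x X
    using that ss by (auto simp: flip_def fun_eq_iff dest: PiE_arb)
  have refl_refl: "refl (refl X) i = X i" for X i
    unfolding refl_def image_image ss by simp
  have flip_refl: "flip x \<in> Pi\<^sub>E D (refl X)" if "x \<in> Pi\<^sub>E D X" for x X
    using that by (auto simp: flip_def refl_def intro!: imageI dest: PiE_mem)
  have flip_in: "flip x \<in> Pi\<^sub>E D X" if "x \<in> Pi\<^sub>E D (refl X)" for x X
    using flip_refl[OF that] PiE_cong[of D "refl (refl X)" X] refl_refl by simp
  have card_refl: "card (refl X i) = card (X i)" for X i
    unfolding refl_def by (rule card_image) (auto intro!: inj_onI simp: s_def split: if_splits)
  have incr: "monotone_pattern D D (refl B) (\<lambda>x. f (flip x))"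
    unfolding monotone_pattern_def
  proof (intro ballI impI)
    fix i x b assume i: "i \<in> D" and x: "x \<in> Pi\<^sub>E D (refl B)" and b: "b \<in> refl B i" "x i < b"
    have xi: "x i \<in> refl B i" using x i by auto
    have x': "x(i := b) \<in> Pi\<^sub>E D (refl B)" using box_updI[OF x b(1)] i by (simp add: insert_absorb)
    have upd: "flip (x(i := t)) = (flip x)(i := s i * t)" for t
      using i by (auto simp: flip_def fun_eq_iff)
    have "f (flip x) < f (flip (x(i := b)))"
    proof (cases "i \<in> S")
      case True
      have "s i * b \<in> B i" using b(1) refl_refl[of B i] unfolding refl_def by blast
      moreover have "flip x i < s i * b" using True b(2) i by (simp add: flip_def s_def)
      ultimately show ?thesis
        using S i flip_in[OF x] True unfolding upd monotone_pattern_def by auto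
    next
      case False
      \<comment> \<open>The reflection reverses the order in coordinate \<open>i\<close>, so
        \<open>flip (x(i := b))\<close> is now the lower point to which the pattern applies.\<close>
      have "s i * x i \<in> B i" using xi refl_refl[of B i] unfolding refl_def by blast
      moreover have "flip (x(i := b)) i < s i * x i" using False b(2) i by (simp add: flip_def s_def)
      ultimately have "f ((flip (x(i := b)))(i := s i * x i)) < f (flip (x(i := b)))"
        using S i flip_in[OF x'] False unfolding monotone_pattern_def by auto
      moreover have "(flip (x(i := b)))(i := s i * x i) = flip x"
        using upd[of "x i"] upd[of b] by simp
      ultimately show ?thesis by simp
    qed
    then show "if i \<in> D then f (flip x) < f (flip (x(i := b))) else f (flip (x(i := b))) < f (flip x)"
      using i by simp
  qed
  have "finite (B i)" "card (B i) = K" if "i \<in> D" for i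
    using sub_boxesD[OF B that] f that finite_subset[of "B i" "A i"] unfolding D_def is_array_def by auto
  then have "\<exists>C\<in>sub_boxes D (refl B) (\<lambda>_. n). \<exists>is. distinct is \<and> set is = D \<and>
      lex_increasing is C (\<lambda>x. f (flip x))"
    using lex[unfolded forces_lex_def, rule_format, of D "refl B"] D incr card_refl[of B]
    by (auto simp: refl_def)
  then obtain C "is" where C: "C \<in> sub_boxes D (refl B) (\<lambda>_. n)"
    and "is": "distinct is" "set is = D" "lex_increasing is C (\<lambda>x. f (flip x))" by blast
  have len: "length is = d" using "is" D by (metis distinct_card)
  define E where "E = refl C"
  have E: "E i \<subseteq> A i" "card (E i) = n" if "i \<in> D" for i
  proof -
    have "E i \<subseteq> refl (refl B) i" using sub_boxesD[OF C that] unfolding E_def refl_def by blast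
    then show "E i \<subseteq> A i" using refl_refl[of B i] sub_boxesD[OF B that] by auto
    show "card (E i) = n" unfolding E_def using card_refl sub_boxesD[OF C that] by simp
  qed
  define g where "g = restrict f (box d E)"
  have "E i \<noteq> {}" if "i \<in> D" for i using E(2)[OF that] \<open>1 \<le> n\<close> by auto
  then have "is_subarray d E g A f"
    unfolding is_subarray_def g_def D_def[symmetric] using E(1) by blast
  moreover have "cubic_size d E n" unfolding cubic_size_def D_def[symmetric] using E(2) by blast
  moreover have "lex_monotone d E g"
  proof (rule lex_monotoneI[OF "is"(1)])
    show "set is = {1..d}" using "is"(2) by (simp add: D_def)
    show "s i \<in> {-1, 1}" for i by (simp add: s_def)
    fix x y k assume x: "x \<in> box d E" and y: "y \<in> box d E" and k: "k < d"
      and eq: "\<And>l. l < k \<Longrightarrow> s (is ! l) * x (is ! l) = s (is ! l) * y (is ! l)"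
      and less: "s (is ! k) * x (is ! k) < s (is ! k) * y (is ! k)"
    have x': "flip x \<in> Pi\<^sub>E D C" and y': "flip y \<in> Pi\<^sub>E D C"
      using x y flip_in unfolding E_def D_def by blast+
    have nth: "is ! l \<in> D" if "l < d" for l using that len "is"(2) nth_mem by blast
    have "f (flip (flip x)) < f (flip (flip y))"
      by (rule lex_increasing_nth[OF "is"(3,1), of _ _ k])
        (use x' y' k len eq less nth "is"(2) in \<open>auto simp: flip_def\<close>)
    then have "f x < f y" using flip_flip x y unfolding D_def by simp
    then show "g x < g y" using x y by (simp add: g_def)
  qed
  ultimately show "\<exists>B g. is_subarray d B g A f \<and> cubic_size d B n \<and> lex_monotone d B g" by blast
qed

section \<open>Quantitative bounds\<close>

text \<open>\<open>(1 + 1 / n) ^ n \<le> e\<close>. This bounded factor is all that the reserve in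
  the greedy choice of windows costs beyond \<open>2 ^ n\<close>.\<close>

lemma Suc_power_le: "(n + 1) ^ n \<le> 4 * (n::nat) ^ n"
proof (cases "n = 0")
  case False
  have "(1 + 1 / real n) ^ n \<le> exp (1 / real n) ^ n"
    using exp_ge_add_one_self[of "1 / real n"] by (intro power_mono) auto
  also have "\<dots> = exp 1" using False by (simp add: exp_of_nat_mult[symmetric])
  also have "\<dots> \<le> 4" using exp_le by simp
  finally have "(1 + 1 / real n) ^ n * real n ^ n \<le> 4 * real n ^ n"
    by (intro mult_right_mono) auto
  moreover have "(1 + 1 / real n) ^ n * real n ^ n = (real n + 1) ^ n"
    using False by (simp add: power_mult_distrib[symmetric] field_simps)
  ultimately have "real ((n + 1) ^ n) \<le> real (4 * n ^ n)" by (simp add: add.commute)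
  then show ?thesis by (simp only: of_nat_le_iff)
qed simp

lemma forces_lex_3:
  assumes n: "1 \<le> n"
  shows "forces_lex 3 n (2 ^ 21 * n ^ 6 * 2 ^ n)"
proof -
  \<comment> \<open>\<open>p ^ n / (n * n) ^ n = 2 ^ n * (1 + 1 / n) ^ n \<le> 4 * 2 ^ n\<close>,
    and the further factor \<open>n\<close> in \<open>v\<close> is the number of slices to
    keep.\<close>
  define p v where "p = 2 * n * (n + 1)" and "v = 4 * n * 2 ^ n"
  have "n * p ^ n = n * 2 ^ n * n ^ n * (n + 1) ^ n" by (simp only: p_def power_mult_distrib mult_ac)
  also have "\<dots> \<le> n * 2 ^ n * n ^ n * (4 * n ^ n)" by (intro mult_le_mono2 Suc_power_le)
  also have "\<dots> = v * (n * n) ^ n" by (simp add: v_def power_mult_distrib)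
  finally have pv: "n * p ^ n \<le> v * (n * n) ^ n" .
  have p: "p \<le> 4 * n ^ 2" using n by (simp add: p_def power2_eq_square)
  have "(2 * 3 * (p * n) + 1) * (3 * (2 * 3 + 1) ^ 3 * (4 * p * v)) \<le>
      (2 * 3 * (4 * n ^ 2 * n) + n ^ 3) * (3 * (2 * 3 + 1) ^ 3 * (4 * (4 * n ^ 2) * v))"
    using p n by (intro mult_le_mono add_mono) auto
  also have "2 * 3 * (4 * n ^ 2 * n) + n ^ 3 = 25 * n ^ 3"
    by (simp add: power2_eq_square power3_eq_cube)
  also have "25 * n ^ 3 * (3 * (2 * 3 + 1) ^ 3 * (4 * (4 * n ^ 2) * v)) = 1646400 * (n ^ 3 * n ^ 2 * n ^ 1) * 2 ^ n"
    by (simp add: v_def mult_ac)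
  also have "n ^ 3 * n ^ 2 * n ^ 1 = n ^ 6" by (simp only: power_add[symmetric]) simp
  also have "1646400 * n ^ 6 * 2 ^ n \<le> 2 ^ 21 * n ^ 6 * 2 ^ n" by (intro mult_le_mono1) simp
  finally show ?thesis using forces_lex_mono[OF forces_lex_3_aux[OF n p_def pv]] by blast
qed

lemma exists_forces_lex:
  assumes "1 \<le> d" and "1 \<le> n"
  shows "\<exists>K\<ge>1. forces_lex d n K"
  using assms(1)
proof (induction d rule: dec_induct)
  case base
  then show ?case using forces_lex_1 \<open>1 \<le> n\<close> by blast
next
  case (step d)
  then obtain K where "1 \<le> K" "forces_lex d n K" by blast
  then obtain K' where "forces_lex (Suc d) n K'" using forces_lex_Suc \<open>1 \<le> n\<close> by blast
  then have "forces_lex (Suc d) n (Suc K')" by (rule forces_lex_mono) simp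
  then show ?case by (intro exI[of _ "Suc K'"]) simp
qed

text \<open>Each new dimension raises \<open>K\<close> to the power \<open>(d + 1) * n\<close>, up
  to factors absorbed by the constant, because a key contains one of \<open>(K choose n) ^ d\<close>
  boxes; so the exponent gains a factor \<open>n\<close>. Dimension three must start with a linear
  exponent: the general step applied in dimension two would give one of order
  \<open>n * log n\<close>.\<close>

lemma forces_lex_bound:
  assumes "3 \<le> d"
  shows "\<exists>C. \<forall>n\<ge>1. forces_lex d n (2 ^ (C * n ^ (d - 2)))"
  using assms
proof (induction d rule: dec_induct)
  case base
  have "forces_lex 3 n (2 ^ (28 * n ^ (3 - 2)))" if "1 \<le> n" for n
  proof (rule forces_lex_mono[OF forces_lex_3[OF that]])
    have "2 ^ 21 * n ^ 6 * 2 ^ n \<le> 2 ^ (21 * n) * (2 ^ n) ^ 6 * 2 ^ n"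
      using that by (intro mult_le_mono power_mono power_increasing) (auto simp: less_exp less_imp_le)
    also have "\<dots> = 2 ^ (28 * n ^ (3 - 2))"
      by (simp add: power_mult[symmetric] power_add[symmetric])
    finally show "2 ^ 21 * n ^ 6 * 2 ^ n \<le> (2::nat) ^ (28 * n ^ (3 - 2))" .
  qed
  then show ?case by blast
next
  case (step d)
  then obtain C where C: "\<And>n. 1 \<le> n \<Longrightarrow> forces_lex d n (2 ^ (C * n ^ (d - 2)))" by blast
  define c where "c = (2 * Suc d + 1) * (Suc d * (2 * Suc d + 1) ^ Suc d) * (d ^ d * 2)"
  define C' where "C' = c + 1 + C * (d + 1)"
  have "forces_lex (Suc d) n (2 ^ (C' * n ^ (Suc d - 2)))" if n: "1 \<le> n" for n
  proof -
    define K :: nat where "K = 2 ^ (C * n ^ (d - 2))"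
    define e where "e = n ^ (Suc d - 2)"
    have "1 \<le> K" by (simp add: K_def)
    have "Suc d - 2 = Suc (d - 2)" using step.hyps(1) by arith
    then have e: "n * n ^ (d - 2) = e" by (simp add: e_def)
    have "1 \<le> n ^ (d - 2)" using n by simp
    then have "n * 1 \<le> e" unfolding e[symmetric] by (rule mult_le_mono2)
    then have "1 \<le> e" "n \<le> e" using n by auto
    have "1 \<le> d ^ d * n" using n step.hyps by simp
    then have pos: "1 \<le> (K ^ n) ^ d * d ^ d * n" using \<open>1 \<le> K\<close> by simp
    have "(2 * Suc d * K + 1) * (Suc d * (2 * Suc d + 1) ^ Suc d * ((K choose n) ^ d * d ^ d * n + 1))
        \<le> (2 * Suc d * K + K) * (Suc d * (2 * Suc d + 1) ^ Suc d * ((K ^ n) ^ d * d ^ d * n + (K ^ n) ^ d * d ^ d * n))"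
      using \<open>1 \<le> K\<close> pos by (intro mult_le_mono add_mono power_mono choose_le_power) auto
    also have "\<dots> = c * n * (K * (K ^ n) ^ d)"
      by (simp add: c_def algebra_simps)
    also have "\<dots> \<le> 2 ^ (c * e) * 2 ^ e * (K ^ n * (K ^ n) ^ d)"
    proof (intro mult_le_mono)
      have "c \<le> c * e" using \<open>1 \<le> e\<close> by simp
      also have "\<dots> \<le> 2 ^ (c * e)" by (simp add: less_exp less_imp_le)
      finally show "c \<le> 2 ^ (c * e)" .
      show "n \<le> 2 ^ e" using \<open>n \<le> e\<close> less_exp[of e] by linarith
      show "K \<le> K ^ n" using n \<open>1 \<le> K\<close> by (intro self_le_power) auto
    qed auto
    also have "K ^ n * (K ^ n) ^ d = 2 ^ (C * (d + 1) * e)"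
      unfolding K_def power_mult[symmetric] power_add[symmetric] e[symmetric]
      by (simp add: algebra_simps)
    also have "2 ^ (c * e) * 2 ^ e * 2 ^ (C * (d + 1) * e) = (2::nat) ^ (C' * e)"
      by (simp add: C'_def power_add[symmetric] algebra_simps)
    finally show ?thesis
      using forces_lex_mono[OF forces_lex_Suc[OF C[OF n]]] n \<open>1 \<le> K\<close> unfolding K_def e_def by blast
  qed
  then show ?case by blast
qed

section \<open>Explicit monotone bounds in dimensions one to three\<close>

lemma box_ramsey_singleton: "2 * p i \<le> q i \<Longrightarrow> 1 \<le> p i \<Longrightarrow> box_ramsey {i} q p 2"
  by (rule box_ramsey_insert[OF box_ramsey_empty]) auto

lemma power_minus_2_le: "1 \<le> (a::nat) \<Longrightarrow> (a - 1) ^ 2 + 1 \<le> a ^ 2"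
  by (cases a) (auto simp: power2_eq_square)

lemma forces_monotone_singleton:
  assumes "1 \<le> q i" and "2 * q i ^ 2 \<le> Q i"
  shows "forces_monotone {i} Q q"
proof -
  have "2 * ((q i - 1) ^ 2 + 1) \<le> Q i" using power_minus_2_le[OF assms(1)] assms(2) by simp
  moreover have "0 < Q i" using assms by (cases "Q i") auto
  ultimately show ?thesis
    by (intro forces_monotone_insert[OF forces_monotone_empty[of Q q] box_ramsey_empty[of q q 2]])
      (use assms(1) in auto)
qed

text \<open>On a line Ramsey is the pigeonhole principle, so the intermediate side is only
  \<open>2 * p 1\<close>; this is the origin of the central binomial coefficient and hence of
  \<open>4 ^ k\<close>.\<close>

lemma forces_monotone_pair:
  assumes "1 \<le> p 1" "1 \<le> p 2" and "2 * (2 * p 1) ^ 2 \<le> Q 1" and "0 < Q 2"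
    and "(Q 1 choose (2 * p 1)) * 2 * ((p 2 - 1) ^ (2 * ((2 * p 1) choose p 1)) + 1) \<le> Q 2"
  shows "forces_monotone {1, 2} Q p"
proof -
  define q :: "nat \<Rightarrow> nat" where "q i = 2 * p i" for i
  have "forces_monotone {1} Q q"
    using assms by (intro forces_monotone_singleton) (auto simp: q_def)
  moreover have "box_ramsey {1} q p 2" using assms(1) by (intro box_ramsey_singleton) (auto simp: q_def)
  ultimately have "forces_monotone (insert 2 {1}) Q p"
    using assms by (intro forces_monotone_insert[of _ Q q p]) (auto simp: q_def)
  then show ?thesis by (simp add: insert_commute)
qed

lemma choose_half_le: "(2 * k) choose k \<le> 4 ^ k"
  using binomial_le_pow2[of "2 * k" k] by (simp add: power_mult)

lemma forces_monotone_2: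
  assumes k: "1 \<le> k"
  shows "forces_monotone {1..2} (\<lambda>_. 2 ^ (14 * k ^ 2 * 4 ^ k)) (\<lambda>_. k)"
proof -
  define N :: nat where "N = 2 ^ (14 * k ^ 2 * 4 ^ k)"
  \<comment> \<open>\<open>8 * k ^ 2 = 2 * (2 * k) ^ 2\<close> is the one-dimensional bound for the
    intermediate side \<open>2 * k\<close>. Keeping this side short matters, as its subsets are
    counted as keys.\<close>
  define Q where "Q i = (if i = 1 then 8 * k ^ 2 else N)" for i :: nat
  have kk: "k \<le> k ^ 2" "1 \<le> k ^ 2" using k by (auto simp: power2_eq_square)
  have "(8 * k ^ 2) choose (2 * k) \<le> 2 ^ (8 * k ^ 2)" by (rule binomial_le_pow2)
  moreover have "(k - 1) ^ (2 * ((2 * k) choose k)) + 1 \<le> 2 ^ (k * (2 * 4 ^ k) + 1)"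
    using k choose_half_le[of k] by (intro power_minus_le) (auto simp: less_exp less_imp_le)
  ultimately have "((8 * k ^ 2) choose (2 * k)) * 2 * ((k - 1) ^ (2 * ((2 * k) choose k)) + 1)
      \<le> 2 ^ (8 * k ^ 2) * 2 * 2 ^ (k * (2 * 4 ^ k) + 1)" by (intro mult_le_mono) auto
  also have "\<dots> = 2 ^ (8 * k ^ 2 + 2 + 2 * k * 4 ^ k)" by (simp add: power_add mult_ac)
  also have "\<dots> \<le> N" unfolding N_def
  proof (rule power_increasing)
    define t where "t = k ^ 2 * 4 ^ k"
    have "k ^ 2 \<le> t" "k * 4 ^ k \<le> t" using kk by (auto simp: t_def)
    then have "8 * k ^ 2 + 2 + 2 * (k * 4 ^ k) \<le> 14 * t" using kk by linarith
    then show "8 * k ^ 2 + 2 + 2 * k * 4 ^ k \<le> 14 * k ^ 2 * 4 ^ k" by (simp add: t_def mult.assoc)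
  qed simp
  finally have "forces_monotone {1, 2} Q (\<lambda>_. k)"
    using k by (intro forces_monotone_pair) (auto simp: Q_def N_def power2_eq_square)
  moreover have "Q i \<le> N" for i
  proof -
    have "k ^ 2 * 1 \<le> k ^ 2 * 4 ^ k" by (intro mult_le_mono2) simp
    then have "8 * k ^ 2 \<le> 14 * k ^ 2 * 4 ^ k" by linarith
    also have "\<dots> \<le> N" unfolding N_def by (simp add: less_exp less_imp_le)
    finally show ?thesis by (simp add: Q_def)
  qed
  moreover have "{1..2} = {1, 2 :: nat}" by auto
  ultimately show ?thesis unfolding N_def by (metis forces_monotone_mono)
qed

lemma four_power_eq: "(4::nat) ^ k = 2 ^ (2 * k)"
  by (simp add: power_mult)

text \<open>The base plane needs an intermediate side \<open>q2 \<le> 2 ^ (4 * k)\<close>, and its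
  \<open>k\<close>-subsets number at most \<open>q2 ^ k\<close>; this produces the square of
  \<open>k\<close> in the inner exponent.\<close>

lemma forces_monotone_3:
  assumes k: "1 \<le> k"
  shows "forces_monotone {1..3} (\<lambda>_. 2 ^ (2 ^ (64 * k ^ 2))) (\<lambda>_. k)"
proof -
  define N :: nat where "N = 2 ^ (2 ^ (64 * k ^ 2))"
  \<comment> \<open>This is \<open>4 ^ k * 2 * k\<close>: at most \<open>4 ^ k\<close> subsets of
    the first side, two colours, and \<open>k\<close> values to keep.\<close>
  define q2 where "q2 = k * 2 ^ (2 * k + 1)"
  define Q2 :: nat where "Q2 = 2 ^ (2 ^ (13 * k))"
  \<comment> \<open>\<open>32 * k ^ 2 = 2 * (2 * (2 * k)) ^ 2\<close>: the first side is doubled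
    once for each of the two coordinates added after it.\<close>
  define Q where "Q i = (if i = 1 then 32 * k ^ 2 else if i = 2 then Q2 else N)" for i :: nat
  define q where "q i = (if i = 1 then 2 * k else q2)" for i :: nat
  have kk: "k \<le> k ^ 2" "1 \<le> k ^ 2" using k by (auto simp: power2_eq_square)
  have k2: "k \<le> 2 ^ k" by (simp add: less_exp less_imp_le)
  have pow2: "k ^ 2 \<le> 2 ^ (2 * k)"
    using power_mono[OF k2, of 2] by (simp add: power_mult[symmetric] mult.commute)
  have q2_le: "q2 \<le> 2 ^ (4 * k)"
  proof -
    have "q2 \<le> 2 ^ k * 2 ^ (2 * k + 1)" unfolding q2_def using k2 by (rule mult_le_mono1)
    also have "\<dots> = 2 ^ (k + (2 * k + 1))" by (simp only: power_add)
    also have "\<dots> \<le> 2 ^ (4 * k)" using k by (intro power_increasing) auto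
    finally show ?thesis .
  qed
  have "1 \<le> q2" using k by (simp add: q2_def)
  have size2: "((32 * k ^ 2) choose (2 * (2 * k))) * 2 * ((q2 - 1) ^ (2 * ((2 * (2 * k)) choose (2 * k))) + 1) \<le> Q2"
  proof -
    have "(32 * k ^ 2) choose (2 * (2 * k)) \<le> 2 ^ (32 * k ^ 2)" by (rule binomial_le_pow2)
    moreover have "(q2 - 1) ^ (2 * ((2 * (2 * k)) choose (2 * k))) + 1 \<le> 2 ^ (4 * k * (2 * 4 ^ (2 * k)) + 1)"
      using \<open>1 \<le> q2\<close> q2_le choose_half_le[of "2 * k"] by (intro power_minus_le) auto
    ultimately have "((32 * k ^ 2) choose (2 * (2 * k))) * 2 * ((q2 - 1) ^ (2 * ((2 * (2 * k)) choose (2 * k))) + 1)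
      \<le> 2 ^ (32 * k ^ 2) * 2 * 2 ^ (4 * k * (2 * 4 ^ (2 * k)) + 1)" by (intro mult_le_mono) auto
    also have "\<dots> = 2 ^ (32 * k ^ 2 + 2 + 4 * k * (2 * 4 ^ (2 * k)))" by (simp add: power_add)
    also have "\<dots> \<le> Q2" unfolding Q2_def
    proof (rule power_increasing)
      have "k * 4 ^ (2 * k) \<le> 2 ^ k * 2 ^ (4 * k)"
        using k2 by (intro mult_le_mono) (auto simp: four_power_eq)
      also have "\<dots> = 2 ^ (5 * k)" by (simp add: power_add[symmetric])
      finally have a: "k * 4 ^ (2 * k) \<le> 2 ^ (5 * k)" .
      have b: "k ^ 2 \<le> 2 ^ (5 * k)"
        by (rule le_trans[OF pow2]) (intro power_increasing, auto)
      have c: "(1::nat) \<le> 2 ^ (5 * k)" by simp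
      have "32 * k ^ 2 + 2 + 4 * k * (2 * 4 ^ (2 * k)) = 32 * k ^ 2 + 2 + 8 * (k * 4 ^ (2 * k))" by simp
      also have "\<dots> \<le> 64 * 2 ^ (5 * k)" using a b c by linarith
      also have "\<dots> = 2 ^ (6 + 5 * k)" by (simp add: power_add)
      also have "\<dots> \<le> 2 ^ (13 * k)" using k by (intro power_increasing) auto
      finally show "32 * k ^ 2 + 2 + 4 * k * (2 * 4 ^ (2 * k)) \<le> 2 ^ (13 * k)" .
    qed simp
    finally show ?thesis .
  qed
  have pair: "forces_monotone {1, 2} Q q"
    using k size2 \<open>1 \<le> q2\<close> by (intro forces_monotone_pair) (auto simp: Q_def q_def Q2_def power2_eq_square)
  have ramsey: "box_ramsey {1, 2} q (\<lambda>_. k) 2"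
  proof -
    have "box_ramsey {1} q (\<lambda>_. k) 2" using k by (intro box_ramsey_singleton) (auto simp: q_def)
    moreover have "((2 * k) choose k) * 2 * k \<le> q2"
    proof -
      have "((2 * k) choose k) * 2 * k \<le> 4 ^ k * 2 * k" using choose_half_le by (intro mult_le_mono) auto
      then show ?thesis by (simp add: q2_def four_power_eq)
    qed
    ultimately have "box_ramsey (insert 2 {1}) q (\<lambda>_. k) 2"
      using \<open>1 \<le> q2\<close> k by (elim box_ramsey_insert) (auto simp: q_def)
    then show ?thesis by (simp add: insert_commute)
  qed
  have size3: "((32 * k ^ 2) choose (2 * k)) * (Q2 choose q2) * 4 *
      ((k - 1) ^ (2 * (((2 * k) choose k) * (q2 choose k))) + 1) \<le> N"
  proof -
    have "(32 * k ^ 2) choose (2 * k) \<le> 2 ^ (32 * k ^ 2)" by (rule binomial_le_pow2)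
    moreover have "Q2 choose q2 \<le> 2 ^ (2 ^ (17 * k))"
    proof -
      have "Q2 choose q2 \<le> Q2 ^ q2" by (rule choose_le_power)
      also have "\<dots> = 2 ^ (2 ^ (13 * k) * q2)" by (simp add: Q2_def power_mult)
      also have "\<dots> \<le> 2 ^ (2 ^ (13 * k) * 2 ^ (4 * k))" using q2_le by (intro power_increasing) auto
      also have "2 ^ (13 * k) * 2 ^ (4 * k) = (2::nat) ^ (17 * k)" by (simp add: power_add[symmetric])
      finally show ?thesis .
    qed
    moreover have "(k - 1) ^ (2 * (((2 * k) choose k) * (q2 choose k))) + 1 \<le> 2 ^ (k * 2 ^ (7 * k ^ 2) + 1)"
    proof (rule power_minus_le[OF k k2])
      have "2 * (((2 * k) choose k) * (q2 choose k)) \<le> 2 * (4 ^ k * q2 ^ k)"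
        by (intro mult_le_mono choose_half_le choose_le_power) auto
      also have "\<dots> \<le> 2 * (4 ^ k * (2 ^ (4 * k)) ^ k)" using q2_le by (intro mult_le_mono power_mono) auto
      also have "\<dots> = 2 ^ (1 + 2 * k + 4 * k ^ 2)"
        by (simp add: four_power_eq power_add power_mult[symmetric] power2_eq_square mult_ac)
      also have "\<dots> \<le> 2 ^ (7 * k ^ 2)" using kk by (intro power_increasing) auto
      finally show "2 * (((2 * k) choose k) * (q2 choose k)) \<le> 2 ^ (7 * k ^ 2)" .
    qed
    ultimately have "((32 * k ^ 2) choose (2 * k)) * (Q2 choose q2) * 4 *
        ((k - 1) ^ (2 * (((2 * k) choose k) * (q2 choose k))) + 1)
      \<le> 2 ^ (32 * k ^ 2) * 2 ^ (2 ^ (17 * k)) * 4 * 2 ^ (k * 2 ^ (7 * k ^ 2) + 1)"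
      by (intro mult_le_mono) auto
    also have "\<dots> = 2 ^ (32 * k ^ 2 + 2 ^ (17 * k) + 3 + k * 2 ^ (7 * k ^ 2))" by (simp add: power_add)
    also have "\<dots> \<le> N" unfolding N_def
    proof (rule power_increasing)
      have "k * 2 ^ (7 * k ^ 2) \<le> 2 ^ k * 2 ^ (7 * k ^ 2)" using k2 by (rule mult_le_mono1)
      also have "\<dots> = 2 ^ (k + 7 * k ^ 2)" by (simp only: power_add)
      also have "\<dots> \<le> 2 ^ (17 * k ^ 2)" using kk by (intro power_increasing) auto
      finally have a: "k * 2 ^ (7 * k ^ 2) \<le> 2 ^ (17 * k ^ 2)" .
      have b: "(2::nat) ^ (17 * k) \<le> 2 ^ (17 * k ^ 2)" using kk by (intro power_increasing) auto
      have "k ^ 2 \<le> 2 ^ (k ^ 2)" by (simp add: less_exp less_imp_le)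
      also have "\<dots> \<le> 2 ^ (17 * k ^ 2)" by (intro power_increasing) auto
      finally have c: "k ^ 2 \<le> 2 ^ (17 * k ^ 2)" .
      have d: "(1::nat) \<le> 2 ^ (17 * k ^ 2)" by simp
      have "32 * k ^ 2 + 2 ^ (17 * k) + 3 + k * 2 ^ (7 * k ^ 2) \<le> 64 * 2 ^ (17 * k ^ 2)"
        using a b c d by linarith
      also have "\<dots> = 2 ^ (6 + 17 * k ^ 2)" by (simp add: power_add)
      also have "\<dots> \<le> 2 ^ (64 * k ^ 2)" using kk by (intro power_increasing) auto
      finally show "32 * k ^ 2 + 2 ^ (17 * k) + 3 + k * 2 ^ (7 * k ^ 2) \<le> 2 ^ (64 * k ^ 2)" .
    qed simp
    finally show ?thesis .
  qed
  have "forces_monotone (insert 3 {1, 2}) Q (\<lambda>_. k)"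
  proof (rule forces_monotone_insert[OF pair ramsey])
    show "(\<Prod>i\<in>{1, 2}. Q i choose q i) * 2 ^ card {1, 2 :: nat} *
        ((k - 1) ^ (2 * (\<Prod>i\<in>{1, 2}. q i choose k)) + 1) \<le> Q 3"
      using size3 by (simp add: Q_def q_def)
  qed (use k in \<open>auto simp: Q_def N_def\<close>)
  moreover have "Q i \<le> N" for i
  proof -
    have "32 * k ^ 2 \<le> 2 ^ (64 * k ^ 2)"
      using less_exp[of "64 * k ^ 2"] by linarith
    also have "\<dots> \<le> N" unfolding N_def by (simp add: less_exp less_imp_le)
    finally have "32 * k ^ 2 \<le> N" .
    moreover have "Q2 \<le> N" unfolding Q2_def N_def using kk by (intro power_increasing) auto
    ultimately show ?thesis by (simp add: Q_def)
  qed
  moreover have "{1..3} = insert 3 {1, 2 :: nat}" by auto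
  ultimately show ?thesis unfolding N_def by (metis forces_monotone_mono)
qed

section \<open>Bounds on \<open>L\<close>\<close>

lemma L_le:
  assumes "forces_lex_monotone d n N" and "1 \<le> N"
  shows "L d n \<le> N"
  unfolding L_def using assms by (intro Least_le) auto

text \<open>Makes the \<open>LEAST\<close> in \<open>L\<close> meaningful in every dimension; no
  size is tracked, so any \<open>K\<close> will do.\<close>

lemma exists_forces_lex_monotone:
  assumes "1 \<le> d" and "1 \<le> n"
  shows "\<exists>N\<ge>1. forces_lex_monotone d n N"
proof -
  obtain K where "1 \<le> K" "forces_lex d n K" using exists_forces_lex[OF assms] by blast
  obtain c where "forces_monotone {1..d} (\<lambda>_. 2 ^ (2 ^ (2 ^ (c * K ^ c)))) (\<lambda>_. K)"
    using forces_monotone_bound[of "{1..d}"] \<open>1 \<le> K\<close> by auto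
  then have "forces_lex_monotone d n (2 ^ (2 ^ (2 ^ (c * K ^ c))))"
    using forces_lex_monotoneI \<open>forces_lex d n K\<close> \<open>1 \<le> n\<close> by blast
  then show ?thesis by (intro exI conjI) auto
qed

lemma L_2_bound:
  assumes "1 \<le> n"
  shows "L 2 n \<le> 2 ^ (14 * (2 * n ^ 2) ^ 2 * 4 ^ (2 * n ^ 2))"
proof (rule L_le)
  have "1 \<le> 2 * n ^ 2" using assms by simp
  moreover have "forces_lex 2 n (2 * n ^ 2)"
    using forces_lex_2[OF assms] by (simp add: power2_eq_square mult.assoc)
  ultimately show "forces_lex_monotone 2 n (2 ^ (14 * (2 * n ^ 2) ^ 2 * 4 ^ (2 * n ^ 2)))"
    using forces_lex_monotoneI[OF forces_monotone_2 _ assms] by blast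
qed simp

lemma L_3_bound:
  assumes "1 \<le> n"
  shows "L 3 n \<le> 2 ^ (2 ^ (64 * (2 ^ 21 * n ^ 6 * 2 ^ n) ^ 2))"
proof (rule L_le)
  have "1 \<le> 2 ^ 21 * n ^ 6 * 2 ^ n" using assms by simp
  then show "forces_lex_monotone 3 n (2 ^ (2 ^ (64 * (2 ^ 21 * n ^ 6 * 2 ^ n) ^ 2)))"
    using forces_lex_monotoneI[OF forces_monotone_3 forces_lex_3[OF assms] assms] by blast
qed simp

text \<open>For \<open>K = 2 ^ (C * e)\<close> a polynomial in \<open>K\<close> only changes the
  factor of \<open>e\<close>. The four exponentials are the three of the monotone bound and the one
  in \<open>K\<close>.\<close>

lemma L_bound:
  assumes "3 \<le> d"
  shows "\<exists>C. \<forall>n\<ge>1. L d n \<le> 2 ^ (2 ^ (2 ^ (2 ^ (C * n ^ (d - 2)))))"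
proof -
  obtain c where c: "\<And>k. 1 \<le> k \<Longrightarrow> forces_monotone {1..d} (\<lambda>_. 2 ^ (2 ^ (2 ^ (c * k ^ c)))) (\<lambda>_. k)"
    using forces_monotone_bound[of "{1..d}"] by auto
  obtain C where C: "\<And>n. 1 \<le> n \<Longrightarrow> forces_lex d n (2 ^ (C * n ^ (d - 2)))"
    using forces_lex_bound[OF assms] by blast
  have "L d n \<le> 2 ^ (2 ^ (2 ^ (2 ^ ((c + C * c) * n ^ (d - 2)))))" if n: "1 \<le> n" for n
  proof -
    define e where "e = n ^ (d - 2)"
    define K :: nat where "K = 2 ^ (C * e)"
    have "1 \<le> e" using n by (simp add: e_def)
    have "c \<le> c * e" using \<open>1 \<le> e\<close> by simp
    also have "\<dots> \<le> 2 ^ (c * e)" by (simp add: less_exp less_imp_le)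
    finally have "c * K ^ c \<le> 2 ^ (c * e) * K ^ c" by (rule mult_le_mono1)
    also have "\<dots> = 2 ^ ((c + C * c) * e)"
      by (simp add: K_def power_mult[symmetric] power_add[symmetric] algebra_simps)
    finally have le: "2 ^ (2 ^ (2 ^ (c * K ^ c))) \<le> (2::nat) ^ (2 ^ (2 ^ (2 ^ ((c + C * c) * e))))"
      by (intro power_increasing) auto
    have "forces_lex_monotone d n (2 ^ (2 ^ (2 ^ (c * K ^ c))))"
      by (rule forces_lex_monotoneI[OF c _ n]) (use C[OF n] in \<open>auto simp: K_def e_def\<close>)
    then have "L d n \<le> 2 ^ (2 ^ (2 ^ (c * K ^ c)))" by (rule L_le) simp
    then show ?thesis using le unfolding e_def by (rule le_trans)
  qed
  then show ?thesis by blast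
qed

lemma real_two_power: "real (2 ^ m) = 2 powr real m"
  by (simp add: powr_realpow)

theorem theorem1p3:
  shows "(\<forall>d\<ge>1. \<forall>n\<ge>1. \<exists>N\<ge>1. forces_lex_monotone d n N)
    \<and> (\<exists>\<epsilon> :: nat \<Rightarrow> real. \<epsilon> \<longlonglongrightarrow> 0 \<and>
         (\<forall>n\<ge>1. real (L 2 n) \<le> 2 powr (2 powr ((4 + \<epsilon> n) * real n ^ 2))))
    \<and> (\<exists>\<epsilon> :: nat \<Rightarrow> real. \<epsilon> \<longlonglongrightarrow> 0 \<and>
         (\<forall>n\<ge>1. real (L 3 n) \<le> 2 powr (2 powr (2 powr ((2 + \<epsilon> n) * real n)))))
    \<and> (\<forall>d\<ge>4. \<exists>C :: real. \<forall>n\<ge>1. real (L d n) \<le> towr 5 (C * real n ^ (d - 2)))"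
proof (intro conjI)
  show "\<forall>d\<ge>1. \<forall>n\<ge>1. \<exists>N\<ge>1. forces_lex_monotone d n N"
    using exists_forces_lex_monotone by blast
next
  \<comment> \<open>\<open>14 * (2 * n ^ 2) ^ 2 = 56 * n ^ 4\<close> is the polynomial factor; moved
    into \<open>\<epsilon>\<close> it reproduces the natural-number bound exactly.\<close>
  define \<epsilon> :: "nat \<Rightarrow> real" where "\<epsilon> n = log 2 (56 * real n ^ 4) / real n ^ 2" for n
  have "\<epsilon> \<longlonglongrightarrow> 0" unfolding \<epsilon>_def by real_asymp
  moreover have "real (L 2 n) \<le> 2 powr (2 powr ((4 + \<epsilon> n) * real n ^ 2))" if "1 \<le> n" for n
  proof -
    have "2 powr ((4 + \<epsilon> n) * real n ^ 2) = 2 powr (4 * real n ^ 2 + log 2 (56 * real n ^ 4))"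
      using that by (simp add: \<epsilon>_def distrib_right)
    also have "\<dots> = 2 powr (real (4 * n ^ 2)) * (56 * real n ^ 4)"
      using that by (simp add: powr_add)
    also have "\<dots> = real (14 * (2 * n ^ 2) ^ 2 * 4 ^ (2 * n ^ 2))"
      unfolding powr_realpow[OF zero_less_numeral] four_power_eq
      by (simp add: power_mult[symmetric] power_mult_distrib mult_ac)
    finally have "2 powr (2 powr ((4 + \<epsilon> n) * real n ^ 2)) = real (2 ^ (14 * (2 * n ^ 2) ^ 2 * 4 ^ (2 * n ^ 2)))"
      by (simp only: real_two_power)
    then show ?thesis using L_2_bound[OF that] by (simp only: of_nat_le_iff)
  qed
  ultimately show "\<exists>\<epsilon> :: nat \<Rightarrow> real. \<epsilon> \<longlonglongrightarrow> 0 \<and>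
      (\<forall>n\<ge>1. real (L 2 n) \<le> 2 powr (2 powr ((4 + \<epsilon> n) * real n ^ 2)))" by blast
next
  \<comment> \<open>\<open>64 * (2 ^ 21 * n ^ 6) ^ 2 = 2 ^ 48 * n ^ 12\<close> is the polynomial
    factor beside \<open>2 ^ (2 * n)\<close>.\<close>
  define \<epsilon> :: "nat \<Rightarrow> real" where "\<epsilon> n = log 2 (2 ^ 48 * real n ^ 12) / real n" for n
  have "\<epsilon> \<longlonglongrightarrow> 0" unfolding \<epsilon>_def by real_asymp
  moreover have "real (L 3 n) \<le> 2 powr (2 powr (2 powr ((2 + \<epsilon> n) * real n)))" if "1 \<le> n" for n
  proof -
    have "2 powr ((2 + \<epsilon> n) * real n) = 2 powr (2 * real n + log 2 (2 ^ 48 * real n ^ 12))"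
      using that by (simp add: \<epsilon>_def distrib_right)
    also have "\<dots> = 2 powr (real (2 * n)) * (2 ^ 48 * real n ^ 12)"
      using that by (simp add: powr_add)
    also have "\<dots> = real (64 * (2 ^ 21 * n ^ 6 * 2 ^ n) ^ 2)"
      unfolding powr_realpow[OF zero_less_numeral]
      by (simp add: power_mult[symmetric] power_mult_distrib mult_ac)
    finally have "2 powr (2 powr (2 powr ((2 + \<epsilon> n) * real n))) = real (2 ^ (2 ^ (64 * (2 ^ 21 * n ^ 6 * 2 ^ n) ^ 2)))"
      by (simp only: real_two_power)
    then show ?thesis using L_3_bound[OF that] by (simp only: of_nat_le_iff)
  qed
  ultimately show "\<exists>\<epsilon> :: nat \<Rightarrow> real. \<epsilon> \<longlonglongrightarrow> 0 \<and>
      (\<forall>n\<ge>1. real (L 3 n) \<le> 2 powr (2 powr (2 powr ((2 + \<epsilon> n) * real n))))" by blast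
next
  show "\<forall>d\<ge>4. \<exists>C :: real. \<forall>n\<ge>1. real (L d n) \<le> towr 5 (C * real n ^ (d - 2))"
  proof (intro allI impI)
    fix d :: nat assume "4 \<le> d"
    then obtain C where C: "\<And>n. 1 \<le> n \<Longrightarrow> L d n \<le> 2 ^ (2 ^ (2 ^ (2 ^ (C * n ^ (d - 2)))))"
      using L_bound[of d] by auto
    have "real (L d n) \<le> towr 5 (real C * real n ^ (d - 2))" if "1 \<le> n" for n
    proof -
      \<comment> \<open>With indexing from 1, \<open>towr 5\<close> is four exponentials.\<close>
      have "towr 5 x = 2 powr (2 powr (2 powr (2 powr x)))" for x
        by (simp add: eval_nat_numeral)
      then have "towr 5 (real C * real n ^ (d - 2)) = 2 powr (2 powr (2 powr (2 powr real (C * n ^ (d - 2)))))"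
        by simp
      also have "\<dots> = real (2 ^ (2 ^ (2 ^ (2 ^ (C * n ^ (d - 2))))))"
        by (simp only: real_two_power)
      finally show ?thesis using C[OF that] by (simp only: of_nat_le_iff)
    qed
    then show "\<exists>C :: real. \<forall>n\<ge>1. real (L d n) \<le> towr 5 (C * real n ^ (d - 2))" by blast
  qed
qed

end
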